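(* Let $J\ge0$ be a function in $L^1(\mathbb{R}^2)$ with $\int_{\mathbb{R}^2}J(z)|z|^2\,dz<\infty$. Let $\eta>1$ satisfy $$1+\frac{\log 2-\log(\eta-1)}{\log\eta}\notin\mathbb{Q},$$ and let $\Omega=\Omega(\eta)\subset\mathbb{R}^2$ be the Koch snowflake of scale $\eta$. Let $\alpha(\eta)\in(1,2)$ be the Minkowski dimension of $\partial\Omega$, i.e. the number satisfying $$2\Big(\frac{\eta-1}{2\eta}\Big)^{\alpha(\eta)}+2\Big(\frac1\eta\Big)^{\alpha(\eta)}=1 .$$ Then the limit $$\lim_{t\to0^+}\frac{1}{t^{4-\alpha(\eta)}}\int_{\Omega}\int_{\Omega^c}J\Big(\frac{x-y}{t}\Big)\,dx\,dy$$ exists.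
   Context: Koch snowflake of scale $\eta>1$: start with an equilateral triangle of side length $1$. On each side (a line segment of length $\ell$), add an outward equilateral triangle of side length $\ell/\eta$ placed at the middle of the segment, replacing the segment by $4$ segments (two of length $\ell(\eta-1)/(2\eta)$ and two of length $\ell/\eta$). Repeat this operation iteratively on every segment obtained; the limiting bounded open set is the Koch snowflake $\Omega(\eta)$ of scale $\eta$ (the case $\eta=3$ is the standard Koch snowflake). $\Omega^c=\mathbb{R}^2\setminus\Omega$. *)

theory Defs
  imports "HOL-Analysis.Analysis"
begin

text \<open>The plane R^2 is modelled by the type complex.  Segments are oriented pairs
  (a, b); the initial triangle 0, 1, cis(pi/3) is traversed counterclockwise, so
  the outward side of a segment is on its right.\<close>

definition koch_pts :: "real \<Rightarrow> complex \<times> complex \<Rightarrow> complex \<times> complex \<times> complex" where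
  "koch_pts \<eta> s = (let a = fst s; b = snd s;
       p1 = a + (b - a) * of_real ((\<eta> - 1) / (2 * \<eta>));
       p3 = b - (b - a) * of_real ((\<eta> - 1) / (2 * \<eta>));
       p2 = p1 + (p3 - p1) * cis (- pi / 3)
     in (p1, p2, p3))"

definition koch_refine :: "real \<Rightarrow> complex \<times> complex \<Rightarrow> (complex \<times> complex) list" where
  "koch_refine \<eta> s = (case koch_pts \<eta> s of (p1, p2, p3) \<Rightarrow>
      [(fst s, p1), (p1, p2), (p2, p3), (p3, snd s)])"

definition koch_tri :: "real \<Rightarrow> complex \<times> complex \<Rightarrow> complex set" where
  "koch_tri \<eta> s = (case koch_pts \<eta> s of (p1, p2, p3) \<Rightarrow> convex hull {p1, p2, p3})"

fun koch_segs :: "real \<Rightarrow> nat \<Rightarrow> (complex \<times> complex) list" where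
  "koch_segs \<eta> 0 = [(0, 1), (1, cis (pi / 3)), (cis (pi / 3), 0)]"
| "koch_segs \<eta> (Suc n) = concat (map (koch_refine \<eta>) (koch_segs \<eta> n))"

definition koch_snowflake :: "real \<Rightarrow> complex set" where
  "koch_snowflake \<eta> = interior (closure
     (convex hull {0, 1, cis (pi / 3)} \<union>
      (\<Union>n. \<Union>s\<in>set (koch_segs \<eta> n). koch_tri \<eta> s)))"

end

(* For a set X let q(h) = |{x in X. x + h not in X}|.  By Fubini the double integral equals
   t^2 * int J(z) q(t z) dz for X = Omega, so by dominated convergence it suffices that
   q(t z) / t^(2 - alpha) converges for every z and is bounded by a multiple of 1 + |z|^2.
   If alpha >= 2 this is immediate because Omega is open with finite area.

   If alpha < 2, the region A attached to one side is a triangle together with four scaled copies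
   of itself.  Triangles contribute O(|h|) = o(|h|^(2 - alpha)), and q is subadditive under unions,
   whether or not the copies overlap.  Averaging the loss of A over the rotations by multiples of
   pi/3 gives a function that, normalised by |h|^(2 - alpha) and up to a negligible term, is at
   most a convex combination of its own values at two rescaled arguments.  A bounded uniformly
   continuous function with this property converges along rays when the two logarithmic scales
   are incommensurable.  Convergence forces the defect in the subadditivity to be
   o(|h|^(2 - alpha)).  The corner between two neighbouring sides of the snowflake is similar to
   the corner at the tip of the first bump of A, so the losses of the three sides also add up to
   leading order, which gives the limit for Omega itself; no geometric separation of the copies
   is needed, and self-overlapping snowflakes (eta close to 1) are covered. *)

theory Submission
  imports Defs
begin

section \<open>Plane similarities and Lebesgue measure\<close>

text \<open>Shifting a turned copy of \<open>A\<close> amounts to shifting \<open>A\<close> by the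
  vector turned back. The outer copies keep the direction of h and the two central ones turn it by
  pi/3 either way, so the recursion for the loss of \<open>A\<close> couples different directions;
  the orbit sum closes it into a scalar recursion on a single ray. The same sum is exactly the sum
  of the losses of the three sides, whose directions differ by multiples of pi/3. Overlaps and
  shared corners are not controlled, so only inequalities are available and the renewal argument is
  one-sided. In logarithmic scale its steps are -ln a and -ln r, whose ratio is the number assumed
  irrational. Once the normalised orbit sum has a limit l, the normalised total defect tends to (2
  a^\<alpha> + 2 r^\<alpha> - 1) l = 0, whatever the value of l. The equation for \<alpha> has its
  root at or above 2 exactly when \<eta> \<le> sqrt 6 - 1; there t^(2 - \<alpha>) no longer tends to
  0.\<close>

lemma lborel_distr_rotation:
  fixes c :: complex
  assumes "cmod c = 1"
  shows "distr lborel borel ((*) c) = lborel"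
proof -
  \<comment> \<open>The isometry \<open>g\<close> carries Lebesgue measure of \<open>real^2\<close>
    to that of the plane, so that invariance under orthogonal maps of \<open>real^2\<close> can be
    transported.\<close>
  define g :: "real^2 \<Rightarrow> complex" where "g v = Complex (v$1) (v$2)" for v
  define g' :: "complex \<Rightarrow> real^2" where "g' z = vector [Re z, Im z]" for z
  have lin_g: "linear g"
    unfolding g_def by (intro linearI) (auto simp: complex_eq_iff)
  have lin_g': "linear g'"
    unfolding g'_def by (intro linearI) (auto simp: vec_eq_iff forall_2)
  have gg' [simp]: "g (g' z) = z" for z by (simp add: g_def g'_def)
  have g'g [simp]: "g' (g v) = v" for v by (simp add: g_def g'_def vec_eq_iff forall_2)
  have norm_g: "norm (g v) = norm v" for v
    by (simp add: g_def cmod_def norm_vec_def L2_set_def sum_2)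
  have norm_g': "norm (g' z) = norm z" for z using norm_g[of "g' z"] by simp
  have [measurable]: "g \<in> borel_measurable borel" "g' \<in> borel_measurable borel"
    using lin_g lin_g' by (auto intro!: borel_measurable_continuous_onI linear_continuous_on
        simp: linear_conv_bounded_linear)
  have distr_g: "distr lborel borel g = lborel"
  proof (rule sym, rule lborel_eqI)
    fix l u :: complex
    assume lu: "\<And>b. b \<in> Basis \<Longrightarrow> l \<bullet> b \<le> u \<bullet> b"
    have eq: "g -` box l u = box (g' l) (g' u)"
      by (auto simp: g_def g'_def box_def Basis_complex_def inner_axis Basis_vec_def
          forall_2 axis_eq_axis inner_complex_def)
    have le: "Re l \<le> Re u" "Im l \<le> Im u"
      using lu[of 1] lu[of \<i>] by (auto simp: Basis_complex_def inner_complex_def)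
    have "emeasure (distr lborel borel g) (box l u) = emeasure lborel (box (g' l) (g' u))"
      by (simp add: emeasure_distr eq)
    also have "\<dots> = ennreal (\<Prod>b\<in>Basis. (g' u - g' l) \<bullet> b)"
    proof (rule emeasure_lborel_box)
      have "g' l $ i \<le> g' u $ i" for i using exhaust_2[of i] le by (auto simp: g'_def)
      then show "g' l \<bullet> b \<le> g' u \<bullet> b" if "b \<in> Basis" for b
        using that by (auto simp: Basis_vec_def inner_axis)
    qed
    also have "(\<Prod>b\<in>Basis. (g' u - g' l) \<bullet> b) = (\<Prod>i\<in>UNIV. (g' u - g' l) $ i)"
      by (simp add: Basis_vec_def prod.reindex axis_eq_axis inj_on_def inner_axis
          UNION_singleton_eq_range)
    also have "\<dots> = (\<Prod>b\<in>Basis. (u - l) \<bullet> b)"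
      by (simp add: Basis_complex_def prod_2 UNIV_2 g'_def inner_complex_def)
    finally show "emeasure (distr lborel borel g) (box l u) = (\<Prod>b\<in>Basis. (u - l) \<bullet> b)" .
  qed simp
  show ?thesis
  proof (rule sym, rule lborel_eqI)
    fix l u :: complex
    assume lu: "\<And>b. b \<in> Basis \<Longrightarrow> l \<bullet> b \<le> u \<bullet> b"
    define B where "B = g -` box l u"
    have [measurable]: "B \<in> sets borel"
      unfolding B_def by (rule measurable_sets_borel[where M=borel]) auto
    have eB: "emeasure lborel B = emeasure lborel (box l u)"
      using emeasure_distr[of g lborel borel "box l u"] by (simp add: B_def distr_g)
    have Bl: "B \<in> lmeasurable"
      using eB by (auto simp: fmeasurable_def emeasure_lborel_box_eq)
    \<comment> \<open>The inverse rotation in coordinates: a preimage under multiplication by c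
      becomes an image under an orthogonal map.\<close>
    define f where "f v = g' (inverse c * g v)" for v
    have c0: "c \<noteq> 0" using assms by auto
    have "linear f" unfolding f_def
      using linear_compose[OF linear_compose[OF lin_g] lin_g', of "\<lambda>z. inverse c * z"]
      by (auto simp: o_def bounded_linear_mult_right bounded_linear.linear)
    moreover have "norm (f v) = norm v" for v
      using assms by (simp add: f_def norm_g' norm_mult norm_g norm_inverse)
    ultimately have orth: "orthogonal_transformation f"
      by (simp add: orthogonal_transformation)
    have img: "g -` ((*) c -` box l u) = f ` B"
    proof (intro set_eqI iffI)
      fix v assume "v \<in> g -` ((*) c -` box l u)"
      then have "g' (c * g v) \<in> B" by (simp add: B_def)
      moreover have "v = f (g' (c * g v))" using c0 by (simp add: f_def flip: mult.assoc)
      ultimately show "v \<in> f ` B" by blast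
    next
      fix v assume "v \<in> f ` B"
      then show "v \<in> g -` ((*) c -` box l u)" using c0 by (auto simp: B_def f_def simp flip: mult.assoc)
    qed
    have [measurable]: "(*) c -` box l u \<in> sets borel"
      by (rule measurable_sets_borel[where M=borel]) auto
    have fB: "f ` B \<in> sets borel"
      unfolding img[symmetric] by (rule measurable_sets_borel[where M=borel]) auto
    have "emeasure (distr lborel borel ((*) c)) (box l u) = emeasure lborel ((*) c -` box l u)"
      by (simp add: emeasure_distr)
    also have "\<dots> = emeasure lborel (f ` B)"
      by (subst distr_g[symmetric]) (simp add: emeasure_distr img)
    also have "\<dots> = emeasure lebesgue (f ` B)" using fB by simp
    also have "\<dots> = emeasure lebesgue B"
      using measure_orthogonal_image[OF orth Bl] measurable_orthogonal_image[OF orth Bl] Bl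
      by (simp add: emeasure_eq_measure2)
    also have "\<dots> = emeasure lborel (box l u)" using eB by simp
    finally show "emeasure (distr lborel borel ((*) c)) (box l u) = (\<Prod>b\<in>Basis. (u - l) \<bullet> b)"
      using lu by simp
  qed simp
qed

text \<open>Polar form c = |c| e: the dilation contributes the factor |c|^2 and the rotation
  preserves the measure.\<close>

lemma emeasure_lborel_similarity:
  fixes c d :: complex
  assumes "c \<noteq> 0" and [measurable]: "X \<in> sets borel"
  shows "emeasure lborel X = (cmod c)\<^sup>2 * emeasure lborel {z. c * z + d \<in> X}"
proof -
  define e where "e = c / cmod c"
  have e: "cmod e = 1" "c = cmod c * e" using assms by (auto simp: e_def norm_divide)
  have "lborel = density (distr lborel borel (\<lambda>x. d + cmod c *\<^sub>R x)) (\<lambda>_. \<bar>cmod c\<bar>^DIM(complex))"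
    by (rule lborel_affine) (use assms in auto)
  then have "emeasure lborel X =
      emeasure (density (distr lborel borel (\<lambda>x. d + cmod c *\<^sub>R x)) (\<lambda>_. \<bar>cmod c\<bar>^DIM(complex))) X"
    by simp
  also have "\<dots> = (cmod c)\<^sup>2 * emeasure lborel ((\<lambda>x. d + cmod c *\<^sub>R x) -` X)"
    by (simp add: emeasure_density_const emeasure_distr power2_eq_square)
  also have "emeasure lborel ((\<lambda>x. d + cmod c *\<^sub>R x) -` X) = 
     emeasure (distr lborel borel ((*) e)) ((\<lambda>x. d + cmod c *\<^sub>R x) -` X)"
    using e by (simp add: lborel_distr_rotation)
  also have "\<dots> = emeasure lborel {z. c * z + d \<in> X}"
  proof -
    have "(*) e -` (\<lambda>x. d + cmod c *\<^sub>R x) -` X = {z. c * z + d \<in> X}"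
      by (subst (2) e(2)) (auto simp: scaleR_conv_of_real algebra_simps)
    moreover have "(\<lambda>x. d + cmod c *\<^sub>R x) -` X \<in> sets borel"
      by (rule measurable_sets_borel[where M=borel]) auto
    ultimately show ?thesis by (simp add: emeasure_distr)
  qed
  finally show ?thesis .
qed

section \<open>Area lost under a translation\<close>

text \<open>For X of finite area this is |X| minus the covariogram |X \<inter> (X - h)|. Since
  \<open>measure\<close> is 0 on sets of infinite measure, the lemmas below ask for
  \<open>fmeasurable\<close> sets.\<close>

definition shift_loss :: "'a::euclidean_space set \<Rightarrow> 'a \<Rightarrow> real" where
  "shift_loss X h = measure lborel {x \<in> X. x + h \<notin> X}"

lemma emeasure_lborel_translation:
  fixes X :: "'a::euclidean_space set"
  assumes [measurable]: "X \<in> sets borel"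
  shows "emeasure lborel {x. x + h \<in> X} = emeasure lborel X"
proof -
  have "emeasure lborel X = emeasure (distr lborel borel ((+) h)) X"
    by (simp add: lborel_distr_plus)
  also have "\<dots> = emeasure lborel {x. x + h \<in> X}"
    by (subst emeasure_distr) (auto simp: vimage_def add.commute)
  finally show ?thesis ..
qed

lemma measure_lborel_translation:
  fixes X :: "'a::euclidean_space set"
  assumes "X \<in> sets borel"
  shows "measure lborel {x. x + h \<in> X} = measure lborel X"
  using emeasure_lborel_translation[OF assms, of h] by (simp add: measure_def)

lemma sets_borel_shift [measurable]:
  fixes X :: "'a::euclidean_space set"
  assumes [measurable]: "X \<in> sets borel"
  shows "{x. x + h \<in> X} \<in> sets borel"
  by measurable

lemma fmeasurable_lborel_shift:
  fixes X :: "'a::euclidean_space set"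
  assumes "X \<in> fmeasurable lborel"
  shows "{x. x + h \<in> X} \<in> fmeasurable lborel"
  using assms emeasure_lborel_translation[of X h] sets_borel_shift[of X h]
  by (auto simp: fmeasurable_def)

lemma fmeasurable_shift_loss:
  fixes X :: "'a::euclidean_space set"
  assumes "X \<in> fmeasurable lborel"
  shows "{x \<in> X. x + h \<notin> X} \<in> fmeasurable lborel"
proof -
  have "{x \<in> X. x + h \<notin> X} = X - {x. x + h \<in> X}" by auto
  then show ?thesis using fmeasurable_Diff[OF assms] assms sets_borel_shift[of X h]
    by (auto simp: fmeasurable_def)
qed

lemma shift_loss_nonneg [simp]: "0 \<le> shift_loss X h"
  by (simp add: shift_loss_def)

lemma shift_loss_le_measure:
  assumes "X \<in> fmeasurable lborel"
  shows "shift_loss X h \<le> measure lborel X"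
  unfolding shift_loss_def
  by (rule measure_mono_fmeasurable)
     (use assms fmeasurable_shift_loss[OF assms, of h] in \<open>auto intro: fmeasurableD\<close>)

lemma shift_loss_0 [simp]: "shift_loss X 0 = 0"
  by (simp add: shift_loss_def)

lemma shift_loss_Un:
  assumes "X \<in> fmeasurable lborel" "Y \<in> fmeasurable lborel"
  shows "shift_loss (X \<union> Y) h \<le> shift_loss X h + shift_loss Y h"
proof -
  let ?E = "\<lambda>X. {x \<in> X. x + h \<notin> X}"
  have "measure lborel (?E (X \<union> Y)) \<le> measure lborel (?E X \<union> ?E Y)"
    using fmeasurable_shift_loss[OF assms(1), of h] fmeasurable_shift_loss[OF assms(2), of h]
      fmeasurable_shift_loss[OF fmeasurable.Un[OF assms], of h]
    by (intro measure_mono_fmeasurable fmeasurable.Un) (auto dest: fmeasurableD)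
  also have "\<dots> \<le> measure lborel (?E X) + measure lborel (?E Y)"
    using assms fmeasurable_shift_loss by (intro measure_Un_le fmeasurableD) auto
  finally show ?thesis by (simp add: shift_loss_def)
qed

text \<open>Translation by h identifies the two intersections in the covariogram, which is therefore
  even.\<close>

lemma shift_loss_minus:
  assumes "X \<in> fmeasurable lborel"
  shows "shift_loss X (- h) = shift_loss X h"
proof -
  have X: "X \<in> sets borel" using assms by (auto dest: fmeasurableD)
  have loss: "shift_loss X k = measure lborel X - measure lborel (X \<inter> {x. x + k \<in> X})" for k
  proof -
    have "{x \<in> X. x + k \<notin> X} = X - X \<inter> {x. x + k \<in> X}" by auto
    then show ?thesis unfolding shift_loss_def
      using assms X fmeasurable.Int[OF assms fmeasurable_lborel_shift[OF assms, of k]]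
      by (simp add: measurable_measure_Diff)
  qed
  have "measure lborel (X \<inter> {x. x + (- h) \<in> X}) = measure lborel {x. x + h \<in> X \<inter> {x. x + (- h) \<in> X}}"
    by (rule measure_lborel_translation[symmetric]) (use X in measurable)
  also have "{x. x + h \<in> X \<inter> {x. x + (- h) \<in> X}} = X \<inter> {x. x + h \<in> X}" by auto
  finally show ?thesis by (simp add: loss)
qed

text \<open>A point that leaves X under h + k either leaves at the step h or is carried by it to a
  point that leaves at the step k.\<close>

lemma shift_loss_add:
  assumes "X \<in> fmeasurable lborel"
  shows "shift_loss X (h + k) \<le> shift_loss X h + shift_loss X k"
proof -
  let ?E = "\<lambda>h. {x \<in> X. x + h \<notin> X}"
  note fm = fmeasurable_shift_loss[OF assms]
  have "measure lborel (?E (h + k)) \<le> measure lborel (?E h \<union> {x. x + h \<in> ?E k})"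
    using fm fmeasurable_lborel_shift[OF fm]
    by (intro measure_mono_fmeasurable fmeasurable.Un fmeasurableD) (auto simp: add.assoc)
  also have "\<dots> \<le> measure lborel (?E h) + measure lborel {x. x + h \<in> ?E k}"
    using fm fmeasurable_lborel_shift[OF fm] by (intro measure_Un_le fmeasurableD) auto
  also have "measure lborel {x. x + h \<in> ?E k} = measure lborel (?E k)"
    using fmeasurableD[OF fm[of k]] by (intro measure_lborel_translation) simp
  finally show ?thesis by (simp add: shift_loss_def)
qed

lemma abs_shift_loss_diff_le:
  assumes "X \<in> fmeasurable lborel"
  shows "\<bar>shift_loss X h - shift_loss X k\<bar> \<le> shift_loss X (h - k)"
  using shift_loss_add[OF assms, of "h - k" k] shift_loss_add[OF assms, of "k - h" h]
    shift_loss_minus[OF assms, of "h - k"]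
  by simp

text \<open>Translations preserve null sets. This is what allows the snowflake, defined through
  closure and interior, to be exchanged for a union of triangles.\<close>

lemma shift_loss_cong_AE:
  assumes "X \<in> fmeasurable lborel" "Y \<in> fmeasurable lborel"
    and "AE x in lborel. x \<in> X \<longleftrightarrow> x \<in> Y"
  shows "shift_loss X h = shift_loss Y h"
proof -
  have [measurable]: "X \<in> sets borel" "Y \<in> sets borel"
    using assms by (auto dest: fmeasurableD)
  have "AE x in distr lborel borel ((+) h). x \<in> X \<longleftrightarrow> x \<in> Y"
    using assms(3) unfolding lborel_distr_plus .
  then have "AE x in lborel. h + x \<in> X \<longleftrightarrow> h + x \<in> Y"
    by (subst (asm) AE_distr_iff) auto
  with assms(3) have "AE x in lborel. x \<in> {x \<in> X. x + h \<notin> X} \<longleftrightarrow> x \<in> {x \<in> Y. x + h \<notin> Y}"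
    by eventually_elim (auto simp: add.commute)
  then show ?thesis unfolding shift_loss_def
    by (rule measure_eq_AE)
       (use fmeasurable_shift_loss[OF assms(1), of h] fmeasurable_shift_loss[OF assms(2), of h]
         in \<open>auto dest: fmeasurableD\<close>)
qed

lemma
  fixes c d :: complex
  assumes "c \<noteq> 0" and X: "X \<in> fmeasurable lborel"
  shows fmeasurable_similarity: "(\<lambda>z. d + c * z) ` X \<in> fmeasurable lborel" (is "?Y \<in> _")
    and measure_similarity:
      "measure lborel ((\<lambda>z. d + c * z) ` X) = (cmod c)\<^sup>2 * measure lborel X"
proof -
  have X': "X \<in> sets borel" using X by (auto dest: fmeasurableD)
  have eq: "?Y = {z. (1 / c) * z + (- d / c) \<in> X}"
  proof (intro set_eqI iffI)
    fix z assume "z \<in> {z. (1 / c) * z + (- d / c) \<in> X}"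
    moreover have "z = d + c * ((1 / c) * z + (- d / c))" using assms(1) by (simp add: field_simps)
    ultimately show "z \<in> ?Y" by blast
  qed (use assms(1) in \<open>auto simp: field_simps\<close>)
  have Y: "?Y \<in> sets borel"
    unfolding eq using X' by measurable
  have em: "emeasure lborel ?Y = ennreal ((cmod c)\<^sup>2) * emeasure lborel X"
  proof -
    have "emeasure lborel ?Y = ennreal ((cmod c)\<^sup>2) * emeasure lborel {z. c * z + d \<in> ?Y}"
      by (rule emeasure_lborel_similarity) (use assms(1) Y in auto)
    also have "{z. c * z + d \<in> ?Y} = X" using assms(1) by (auto simp: add.commute)
    finally show ?thesis .
  qed
  show "?Y \<in> fmeasurable lborel"
    using Y X em by (auto simp: fmeasurable_def ennreal_mult_less_top)
  show "measure lborel ?Y = (cmod c)\<^sup>2 * measure lborel X"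
    using em by (simp add: measure_def enn2real_mult)
qed

lemma shift_loss_similarity:
  fixes c d :: complex
  assumes "c \<noteq> 0" and X: "X \<in> fmeasurable lborel"
  shows "shift_loss ((\<lambda>z. d + c * z) ` X) h = (cmod c)\<^sup>2 * shift_loss X (h / c)"
proof -
  let ?f = "\<lambda>z. d + c * z"
  have "d + c * z + h \<in> ?f ` X \<longleftrightarrow> z + h / c \<in> X" for z
  proof -
    have "d + c * z + h = ?f (z + h / c)" using assms(1) by (simp add: field_simps)
    then show ?thesis using assms(1) by auto
  qed
  then have "{y \<in> ?f ` X. y + h \<notin> ?f ` X} = ?f ` {z \<in> X. z + h / c \<notin> X}" by auto
  then show ?thesis
    unfolding shift_loss_def using measure_similarity[OF assms(1) fmeasurable_shift_loss[OF X]]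
    by simp
qed

text \<open>If X contains a ball of radius \<rho> about x0, its neighbourhood of width |h| lies in
  the dilate of X about x0 by 1 + e, where e = |h| / \<rho>. The area gained is (2 e + e^2) |X|, at
  most 3 e |X| for e \<le> 1; for larger e the whole area |X| is a sufficient bound.\<close>

lemma shift_loss_convex_le:
  fixes X :: "complex set"
  assumes "compact X" "convex X" "interior X \<noteq> {}"
  obtains C where "C \<ge> 0" "\<And>h. shift_loss X h \<le> C * norm h"
proof -
  have X: "X \<in> fmeasurable lborel"
    using assms(1) by (simp add: fmeasurable_compact)
  obtain x0 where "x0 \<in> interior X" using assms(3) by blast
  then obtain \<rho> where \<rho>: "\<rho> > 0" "cball x0 \<rho> \<subseteq> X"
    by (meson mem_interior_cball)
  have "shift_loss X h \<le> (3 * measure lborel X / \<rho>) * norm h" for h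
  proof (cases "norm h \<le> \<rho> \<and> h \<noteq> 0")
    case False
    then consider "h = 0" | "norm h / \<rho> \<ge> 1" using \<rho> by (auto simp: field_simps)
    then show ?thesis
    proof cases
      case 2
      have "shift_loss X h \<le> measure lborel X" by (rule shift_loss_le_measure[OF X])
      also have "\<dots> \<le> 3 * (norm h / \<rho>) * measure lborel X"
        using 2 mult_right_mono[of 1 "3 * (norm h / \<rho>)" "measure lborel X"] by simp
      finally show ?thesis by (simp add: algebra_simps)
    qed simp
  next
    case True
    define e where "e = norm h / \<rho>"
    have e: "e > 0" "e \<le> 1" using True \<rho> by (auto simp: e_def)
    define f where "f z = (- of_real e * x0) + of_real (1 + e) * z" for z :: complex
    have c0: "complex_of_real (1 + e) \<noteq> 0" using e
      by (metis add_pos_pos less_numeral_extra(1,3) of_real_eq_0_iff)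
    have fm: "f ` X \<in> fmeasurable lborel"
      unfolding f_def[abs_def] by (rule fmeasurable_similarity[OF c0 X])
    have "measure lborel (f ` X) = (cmod (of_real (1 + e)))\<^sup>2 * measure lborel X"
      unfolding f_def[abs_def] by (rule measure_similarity[OF c0 X])
    then have mf: "measure lborel (f ` X) = (1 + e)\<^sup>2 * measure lborel X"
      using e by (simp only: norm_of_real power2_abs)
    have sub: "x + k \<in> f ` X" if "x \<in> X" "norm k \<le> norm h" for x k
    proof -
      \<comment> \<open>A convex combination of x and a point of the inner ball, weighted so that
        the dilation \<open>f\<close> maps it to x + k.\<close>
      define y where "y = (1 / (1 + e)) *\<^sub>R x + (e / (1 + e)) *\<^sub>R (x0 + (1 / e) *\<^sub>R k)"
      have "norm ((1 / e) *\<^sub>R k) \<le> \<rho>"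
        using that e \<rho> True by (simp add: e_def field_simps)
      then have "x0 + (1 / e) *\<^sub>R k \<in> X" using \<rho>(2) by (auto simp: dist_norm)
      then have "y \<in> X"
        unfolding y_def using that assms(2) e by (intro convexD) (auto simp: field_simps)
      moreover have "f y = x + k"
      proof -
        have "(1 + e) *\<^sub>R y =
            ((1 + e) * (1 / (1 + e))) *\<^sub>R x + ((1 + e) * (e / (1 + e))) *\<^sub>R (x0 + (1 / e) *\<^sub>R k)"
          by (simp only: y_def scaleR_add_right scaleR_scaleR mult.assoc)
        also have "\<dots> = x + e *\<^sub>R x0 + k" using e by (simp add: scaleR_add_right)
        finally show ?thesis by (simp add: f_def scaleR_conv_of_real)
      qed
      ultimately show ?thesis by force
    qed
    have "X \<subseteq> f ` X" using sub[of _ 0] by auto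
    \<comment> \<open>Passing to -h and translating replaces the lost points by points outside X
      that one shift carries into X; these lie in the dilate.\<close>
    have "shift_loss X h = shift_loss X (- h)" by (simp add: shift_loss_minus[OF X])
    also have "\<dots> = measure lborel {y. y + h \<in> {x \<in> X. x + - h \<notin> X}}"
      unfolding shift_loss_def
      by (rule measure_lborel_translation[symmetric])
         (use fmeasurable_shift_loss[OF X, of "- h"] in \<open>auto dest: fmeasurableD\<close>)
    also have "\<dots> \<le> measure lborel (f ` X - X)"
    proof (rule measure_mono_fmeasurable)
      show "{y. y + h \<in> {x \<in> X. x + - h \<notin> X}} \<subseteq> f ` X - X"
        using sub[of _ "- h"] by fastforce
      show "{y. y + h \<in> {x \<in> X. x + - h \<notin> X}} \<in> sets lborel"
        using fmeasurable_lborel_shift[OF fmeasurable_shift_loss[OF X, of "- h"], of h]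
        by (auto dest: fmeasurableD)
      show "f ` X - X \<in> fmeasurable lborel"
        using fm X by (intro fmeasurable_Diff) (auto dest: fmeasurableD)
    qed
    also have "\<dots> = ((1 + e)\<^sup>2 - 1) * measure lborel X"
      using measurable_measure_Diff[OF fm fmeasurableD[OF X] \<open>X \<subseteq> f ` X\<close>]
      by (simp add: mf algebra_simps)
    also have "\<dots> \<le> (3 * e) * measure lborel X"
      using e mult_left_mono[of e 1 e]
      by (intro mult_right_mono) (auto simp: power2_eq_square algebra_simps)
    finally show ?thesis by (simp add: e_def algebra_simps)
  qed
  then show thesis using \<rho> by (intro that[of "3 * measure lborel X / \<rho>"]) auto
qed

text \<open>The inequality holds pointwise for indicators. Each pair defect is a nonnegative integer
  and the left side is at most 3, which explains the factor 3 and leaves only points where all pair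
  defects vanish. There at most one of X, Y, Z loses x, and then x + h avoids all four sets, so the
  union loses x too.\<close>

lemma shift_loss_three_sets:
  fixes X Y Z T :: "'a::euclidean_space set" and h :: 'a
  assumes X: "X \<in> fmeasurable lborel" and Y: "Y \<in> fmeasurable lborel"
    and Z: "Z \<in> fmeasurable lborel" and T: "T \<in> fmeasurable lborel"
  defines "q \<equiv> \<lambda>X. shift_loss X h"
  shows "q X + q Y + q Z \<le> q (X \<union> Y \<union> Z \<union> T) +
    3 * ((q X + q Y + q T - q (X \<union> Y \<union> T)) + (q Y + q Z + q T - q (Y \<union> Z \<union> T))
       + (q Z + q X + q T - q (Z \<union> X \<union> T)))"
proof -
  define e where "e X x = indicat_real {x \<in> X. x + h \<notin> X} x" for X :: "'a set" and x
  have int: "integrable lborel (e X)" and q: "q X = (LINT x|lborel. e X x)"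
    if "X \<in> fmeasurable lborel" for X
    using fmeasurable_shift_loss[OF that, of h]
    by (auto simp: e_def[abs_def] q_def shift_loss_def fmeasurable_def)
  note fm = assms(1-4) fmeasurable.Un[OF fmeasurable.Un[OF fmeasurable.Un[OF X Y] Z] T]
    fmeasurable.Un[OF fmeasurable.Un[OF X Y] T] fmeasurable.Un[OF fmeasurable.Un[OF Y Z] T]
    fmeasurable.Un[OF fmeasurable.Un[OF Z X] T]
  have "0 \<le> (LINT x|lborel. e (X \<union> Y \<union> Z \<union> T) x +
    3 * ((e X x + e Y x + e T x - e (X \<union> Y \<union> T) x) + (e Y x + e Z x + e T x - e (Y \<union> Z \<union> T) x)
       + (e Z x + e X x + e T x - e (Z \<union> X \<union> T) x)) - (e X x + e Y x + e Z x))"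
  proof (rule Bochner_Integration.integral_nonneg)
    fix x
    show "0 \<le> e (X \<union> Y \<union> Z \<union> T) x +
    3 * ((e X x + e Y x + e T x - e (X \<union> Y \<union> T) x) + (e Y x + e Z x + e T x - e (Y \<union> Z \<union> T) x)
       + (e Z x + e X x + e T x - e (Z \<union> X \<union> T) x)) - (e X x + e Y x + e Z x)"
      by (cases "x \<in> X"; cases "x \<in> Y"; cases "x \<in> Z"; cases "x \<in> T"; cases "x + h \<in> X";
          cases "x + h \<in> Y"; cases "x + h \<in> Z"; cases "x + h \<in> T"; simp add: e_def)
  qed
  also have "\<dots> = q (X \<union> Y \<union> Z \<union> T) +
    3 * ((q X + q Y + q T - q (X \<union> Y \<union> T)) + (q Y + q Z + q T - q (Y \<union> Z \<union> T))
       + (q Z + q X + q T - q (Z \<union> X \<union> T))) - (q X + q Y + q Z)"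
    using fm by (simp add: q int)
  finally show ?thesis by simp
qed

section \<open>A renewal theorem for subadditive self-similarity\<close>

text \<open>Irrationality yields d = k A - n B in (0, \<delta>). The multiples of d up to N d cover
  a period B with mesh below \<delta>, and beyond the threshold N n B the multiples of B reach every
  period.\<close>

lemma incommensurable_semigroup_dense:
  fixes A B \<delta> :: real
  assumes "A > 0" "B > 0" "A / B \<notin> \<rat>" "\<delta> > 0"
  obtains L where "\<And>u. u \<ge> L \<Longrightarrow> \<exists>(i :: nat) (j :: nat). \<bar>i * A + j * B - u\<bar> < \<delta>"
proof -
  obtain k where k: "k > 0" "\<bar>frac (real k * (A / B)) - 0\<bar> < \<delta> / B"
    using Kronecker_approx_1_explicit[of "A / B" 0 "\<delta> / B"] assms by auto
  have "real k * (A / B) \<notin> \<int>"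
  proof
    assume "real k * (A / B) \<in> \<int>"
    then have "real k * (A / B) / real k \<in> \<rat>"
      using Ints_subset_Rats by (intro Rats_divide) auto
    then show False using k assms by simp
  qed
  then have fr: "frac (real k * (A / B)) > 0" by (simp add: frac_gt_0_iff)
  define n where "n = nat \<lfloor>real k * (A / B)\<rfloor>"
  have n: "real n = real_of_int \<lfloor>real k * (A / B)\<rfloor>"
    using assms by (simp add: n_def)
  define d where "d = k * A - n * B"
  have "d = B * frac (real k * (A / B))"
    using assms by (simp add: d_def n frac_def field_simps)
  then have d: "d > 0" "d < \<delta>" using fr k assms by (auto simp: field_simps)
  define N where "N = nat \<lceil>B / d\<rceil>"
  have N: "B \<le> N * d"
  proof -
    have "B / d \<le> N" unfolding N_def by (rule real_nat_ceiling_ge)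
    then show ?thesis using d by (simp add: field_simps)
  qed
  have "\<exists>(i :: nat) (j :: nat). \<bar>i * A + j * B - u\<bar> < \<delta>" if u: "u \<ge> N * n * B" for u
  proof -
    define j where "j = nat \<lfloor>(u - N * n * B) / B\<rfloor>"
    have j: "real j = real_of_int \<lfloor>(u - N * n * B) / B\<rfloor>"
      using u assms by (simp add: j_def)
    define w where "w = u - N * n * B - j * B"
    have "w = B * frac ((u - N * n * B) / B)"
      using assms by (simp add: w_def j frac_def field_simps)
    then have w: "0 \<le> w" "w < B" using assms frac_lt_1[of "(u - N * n * B) / B"] by auto
    define i where "i = nat \<lfloor>w / d\<rfloor>"
    have i: "real i = real_of_int \<lfloor>w / d\<rfloor>" using w d by (simp add: i_def)
    have "w - i * d = d * frac (w / d)" using d by (simp add: i frac_def field_simps)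
    then have wi: "0 \<le> w - i * d" "w - i * d < d" using d frac_lt_1[of "w / d"] by auto
    have "i * d < N * d" using wi w N by linarith
    then have iN: "i \<le> N" using d by simp
    \<comment> \<open>Using i times the step d subtracts i n copies of B; the reserve N n B in the
      threshold keeps the coefficient of B nonnegative.\<close>
    define J where "J = (N - i) * n + j"
    have J: "real J = (real N - real i) * n + j" using iN by (simp add: J_def of_nat_diff)
    have "real (i * k) * A + real J * B - u = i * d - w"
      by (simp add: J d_def w_def algebra_simps)
    then have "\<bar>real (i * k) * A + real J * B - u\<bar> < \<delta>"
      using wi d by linarith
    then show ?thesis by blast
  qed
  then show thesis by (rule that)
qed

text \<open>Once f \<le> m on a window of length max A B, both predecessors of a point less than min
  A B further on are already covered, so each induction step advances by min A B.\<close>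

lemma submean_bound_propagates:
  fixes f :: "real \<Rightarrow> real"
  assumes "A > 0" "B > 0" "p > 0" "q > 0" "p + q = 1"
    and sub: "\<And>s. s \<ge> x + max A B \<Longrightarrow> f s \<le> p * f (s - A) + q * f (s - B)"
    and start: "\<And>s. x \<le> s \<Longrightarrow> s \<le> x + max A B \<Longrightarrow> f s \<le> m"
    and "x \<le> s"
  shows "f s \<le> m"
proof -
  have *: "f s \<le> m" if "x \<le> s" "s \<le> x + max A B + n * min A B" for n :: nat and s
    using that
  proof (induction n arbitrary: s)
    case 0
    then show ?case using start by simp
  next
    case (Suc n)
    show ?case
    proof (cases "s \<le> x + max A B")
      case True
      then show ?thesis using start Suc.prems by simp
    next
      case False
      have le: "f (s - A) \<le> m" "f (s - B) \<le> m"
        using Suc.prems False by (intro Suc.IH; simp add: algebra_simps)+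
      have "f s \<le> p * f (s - A) + q * f (s - B)" using sub False by simp
      also have "\<dots> \<le> p * m + q * m"
        using le assms by (intro add_mono mult_left_mono) auto
      also have "\<dots> = m" using assms(5) by (metis distrib_right mult_1)
      finally show ?thesis .
    qed
  qed
  obtain n :: nat where "(s - x - max A B) / min A B \<le> n" using real_arch_simple by blast
  then show ?thesis using *[of s n] assms by (simp add: field_simps)
qed

text \<open>A value below the limit superior propagates forward along the semigroup generated by
  \<open>A\<close> and \<open>B\<close>, which is eventually dense; by uniform continuity it lowers
  the bound on a whole window of length \<open>max A B\<close>, hence on everything after it.\<close>

lemma submean_tendsto:
  fixes f :: "real \<Rightarrow> real"
  assumes AB: "A > 0" "B > 0" "A / B \<notin> \<rat>" and pq: "p > 0" "q > 0" "p + q = 1"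
    and bdd: "\<And>s. s \<ge> s0 \<Longrightarrow> \<bar>f s\<bar> \<le> K"
    and uc: "uniformly_continuous_on {s0..} f"
    and sub: "\<And>s. s \<ge> s0 + max A B \<Longrightarrow> f s \<le> p * f (s - A) + q * f (s - B)"
  shows "\<exists>l. (f \<longlongrightarrow> l) at_top"
proof -
  define W where "W = max A B"
  have W: "A \<le> W" "B \<le> W" "W > 0" using AB by (auto simp: W_def)
  define E where "E = {m. eventually (\<lambda>s. f s \<le> m) at_top}"
  \<comment> \<open>The infimum of the eventual upper bounds is the limit superior, finite because
    |f| \<le> K.\<close>
  define M where "M = Inf E"
  have "K \<in> E" unfolding E_def using bdd
    by (auto simp: eventually_at_top_linorder intro!: exI[of _ s0] dest: abs_le_D1)
  have bel: "bdd_below E"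
  proof (intro bdd_belowI)
    fix m assume "m \<in> E"
    then obtain x where x: "\<And>s. s \<ge> x \<Longrightarrow> f s \<le> m" by (auto simp: E_def eventually_at_top_linorder)
    show "- K \<le> m" using x[of "max x s0"] bdd[of "max x s0"] by simp
  qed
  have above: "eventually (\<lambda>s. f s \<le> M + e) at_top" if e: "e > 0" for e
  proof -
    obtain m where "m \<in> E" "m < M + e"
      using cInf_lessD[of E "M + e"] e \<open>K \<in> E\<close> unfolding M_def by force
    then show ?thesis by (auto simp: E_def elim: eventually_mono)
  qed
  have below: "\<not> eventually (\<lambda>s. f s \<le> M - e) at_top" if "e > 0" for e
    using cInf_lower[OF _ bel, of "M - e"] that by (auto simp: E_def M_def)
  have low: "eventually (\<lambda>s. f s > M - e) at_top" if e: "e > 0" for e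
  proof (rule ccontr)
    assume neg: "\<not> eventually (\<lambda>s. f s > M - e) at_top"
    obtain \<delta> where \<delta>: "\<delta> > 0"
      "\<And>s s'. s \<ge> s0 \<Longrightarrow> s' \<ge> s0 \<Longrightarrow> \<bar>s' - s\<bar> < \<delta> \<Longrightarrow> \<bar>f s' - f s\<bar> < e / 2"
      using uc e unfolding uniformly_continuous_on_def dist_real_def
      by (metis atLeast_iff half_gt_zero)
    obtain L' where L': "\<And>u. u \<ge> L' \<Longrightarrow> \<exists>(i :: nat) (j :: nat). \<bar>i * A + j * B - u\<bar> < \<delta>"
      using incommensurable_semigroup_dense[OF AB \<delta>(1)] by blast
    define L where "L = max L' 0"
    define b where "b = min p q"
    have b: "0 < b" "b \<le> 1" "b \<le> p" "b \<le> q" using pq by (auto simp: b_def)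
    \<comment> \<open>Targets at distance between L and L + W from s are approximated within
      \<delta> by i A + j B; this N bounds i + j for all of them.\<close>
    obtain N :: nat where N: "(L + W + \<delta>) / min A B \<le> N" using real_arch_simple by blast
    \<comment> \<open>What survives of an initial drop e / 2 after N averaging steps, each keeping
      at least the fraction b = min p q. The ceiling used below is only \<kappa> / 2 above M, so the
      surviving drop ends at or below M - \<kappa> / 2.\<close>
    define \<kappa> where "\<kappa> = b ^ N * (e / 2)"
    have \<kappa>: "\<kappa> > 0" using b e by (simp add: \<kappa>_def)
    obtain x where x: "\<And>s. s \<ge> x \<Longrightarrow> f s \<le> M + \<kappa> / 2"
      using above[of "\<kappa> / 2"] \<kappa> by (auto simp: eventually_at_top_linorder)
    define y where "y = max x s0 + W + \<delta>"
    obtain s where s: "s \<ge> y" "f s \<le> M - e"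
      using neg by (auto simp: eventually_at_top_linorder not_less)
    have sx: "s - \<delta> \<ge> x + W" "s - \<delta> \<ge> s0 + W" "s \<ge> s0"
      using s \<delta>(1) W(3) by (auto simp: y_def)
    have near: "f v \<le> M - e / 2" if "\<bar>v - s\<bar> < \<delta>" for v
    proof -
      have "v \<ge> s0" using that sx W by linarith
      then have "\<bar>f v - f s\<bar> < e / 2" using \<delta>(2)[of s v] sx that by simp
      then show ?thesis using s by linarith
    qed
    have step: "f (u + d) \<le> M + \<kappa> / 2 - b * z"
      if u: "u \<ge> x + W" "u \<ge> s0 + W" "f u \<le> M + \<kappa> / 2 - z" and z: "z \<ge> 0"
        and d: "d = A \<or> d = B" for u z d
    proof -
      have x': "u + d - A \<ge> x" "u + d - B \<ge> x" "u + d \<ge> s0 + W" using u d W AB by auto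
      have "f (u + d) \<le> p * f (u + d - A) + q * f (u + d - B)"
        using sub x' by (simp add: W_def)
      also have "\<dots> \<le> M + \<kappa> / 2 - b * z"
      proof (cases "d = A")
        case True
        have "p * f (u + d - A) + q * f (u + d - B) \<le> p * (M + \<kappa> / 2 - z) + q * (M + \<kappa> / 2)"
          using True u x x' pq by (intro add_mono mult_left_mono) auto
        also have "\<dots> = (p + q) * (M + \<kappa> / 2) - p * z" by (simp add: algebra_simps)
        also have "\<dots> \<le> M + \<kappa> / 2 - b * z" using pq b z by (simp add: mult_right_mono)
        finally show ?thesis .
      next
        case False
        then have "d = B" using d by simp
        then have "p * f (u + d - A) + q * f (u + d - B) \<le> p * (M + \<kappa> / 2) + q * (M + \<kappa> / 2 - z)"
          using u x x' pq by (intro add_mono mult_left_mono) auto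
        also have "\<dots> = (p + q) * (M + \<kappa> / 2) - q * z" by (simp add: algebra_simps)
        also have "\<dots> \<le> M + \<kappa> / 2 - b * z" using pq b z by (simp add: mult_right_mono)
        finally show ?thesis .
      qed
      finally show ?thesis .
    qed
    have drop: "f (v + i * A + j * B) \<le> M + \<kappa> / 2 - b ^ (i + j) * (e / 2)"
      if v: "\<bar>v - s\<bar> < \<delta>" for v and i j :: nat
    proof -
      have ge: "v + i * A + j * B \<ge> x + W" "v + i * A + j * B \<ge> s0 + W" for i j :: nat
      proof -
        have "i * A + j * B \<ge> 0" using AB by simp
        then show "v + i * A + j * B \<ge> x + W" "v + i * A + j * B \<ge> s0 + W"
          using v sx by linarith+
      qed
      have fst: "f (v + i * A) \<le> M + \<kappa> / 2 - b ^ i * (e / 2)" for i :: nat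
      proof (induction i)
        case 0
        then show ?case using near[OF v] \<kappa> by simp
      next
        case (Suc i)
        show ?case using step[of "v + i * A" "b ^ i * (e / 2)" A] ge[of i 0] Suc b e
          by (simp add: algebra_simps)
      qed
      show ?thesis
      proof (induction j)
        case 0
        then show ?case using fst by simp
      next
        case (Suc j)
        show ?case using step[of "v + i * A + j * B" "b ^ (i + j) * (e / 2)" B] ge[of i j] Suc b e
          by (simp add: algebra_simps)
      qed
    qed
    have window: "f u \<le> M - \<kappa> / 2" if u: "s + L \<le> u" "u \<le> s + L + W" for u
    proof -
      obtain i j :: nat where ij: "\<bar>i * A + j * B - (u - s)\<bar> < \<delta>"
      proof -
        have "u - s \<ge> L'" using u by (simp add: L_def)
        then show thesis using L' that by blast
      qed
      define v where "v = u - i * A - j * B"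
      have "real (i + j) * min A B = i * min A B + j * min A B" by (simp add: algebra_simps)
      also have "\<dots> \<le> i * A + j * B" by (intro add_mono mult_left_mono) auto
      also have "\<dots> \<le> L + W + \<delta>" using ij u by linarith
      also have "\<dots> \<le> N * min A B" using N AB by (simp add: field_simps)
      finally have ijN: "i + j \<le> N" using AB by simp
      have "f u = f (v + i * A + j * B)" by (simp add: v_def)
      also have "\<dots> \<le> M + \<kappa> / 2 - b ^ (i + j) * (e / 2)"
        by (rule drop) (use ij in \<open>simp add: v_def abs_if split: if_splits\<close>)
      also have "\<dots> \<le> M + \<kappa> / 2 - \<kappa>"
      proof -
        have "b ^ N * (e / 2) \<le> b ^ (i + j) * (e / 2)"
          by (rule mult_right_mono[OF power_decreasing[OF ijN]]) (use b e in auto)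
        then show ?thesis unfolding \<kappa>_def by linarith
      qed
      finally show ?thesis by simp
    qed
    have "f u \<le> M - \<kappa> / 2" if "u \<ge> s + L" for u
    proof (rule submean_bound_propagates[OF AB(1,2) pq, of "s + L" f "M - \<kappa> / 2" u])
      show "f t \<le> p * f (t - A) + q * f (t - B)" if "s + L + max A B \<le> t" for t
        using sub that sx W \<delta>(1) by (simp add: L_def W_def)
    qed (use window that in \<open>auto simp: W_def\<close>)
    then have "eventually (\<lambda>u. f u \<le> M - \<kappa> / 2) at_top"
      by (auto simp: eventually_at_top_linorder)
    then show False using below[of "\<kappa> / 2"] \<kappa> by simp
  qed
  show ?thesis
  proof (intro exI[of _ M] tendstoI)
    fix e :: real assume e: "e > 0"
    show "eventually (\<lambda>s. dist (f s) M < e) at_top"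
      using above[OF half_gt_zero[OF e]] low[OF e]
      by eventually_elim (use e in \<open>auto simp: dist_real_def\<close>)
  qed
qed

section \<open>Power-law normalisation: from functions of the scale t to functions of -ln t\<close>

lemma one_minus_exp_le: "1 - exp (- x) \<le> (x::real)"
  using exp_ge_add_one_self[of "- x"] by simp

text \<open>Two copies of ratio a and two of ratio r, with \<alpha> their similarity dimension: 2
  a^\<alpha> and 2 r^\<alpha> are the weights of a convex combination, and 2 - \<alpha> is the order
  of the loss at small shifts.\<close>

locale contraction_pair =
  fixes a r \<alpha> :: real
  assumes a: "0 < a" "a < 1" and r: "0 < r" "r < 1"
    and \<alpha>: "1 < \<alpha>" "\<alpha> < 2" and dim: "2 * a powr \<alpha> + 2 * r powr \<alpha> = 1"
begin

definition "\<beta> = 2 - \<alpha>"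

lemma \<beta>: "0 < \<beta>" "\<beta> < 1" using \<alpha> by (auto simp: \<beta>_def)

lemma length_gt_1: "2 * a + 2 * r > 1"
proof -
  have "c powr \<alpha> < c" if "0 < c" "c < 1" for c
  proof -
    have "\<alpha> * ln c < 1 * ln c" using that \<alpha> by (intro mult_strict_right_mono_neg) auto
    then have "exp (\<alpha> * ln c) < exp (ln c)" by simp
    then show ?thesis using that by (simp add: powr_def)
  qed
  from this[of a] this[of r] show ?thesis using dim a r by simp
qed

text \<open>The x solving C + x = (2 a + 2 r) x. The recursion turns x t into (2 a + 2 r) x t,
  because the area factor c^2 meets the argument t / c. The denominator is positive because \<alpha>
  > 1 makes each ratio exceed its power.\<close>

definition linear_slack :: "real \<Rightarrow> real" where "linear_slack C = C / (2 * a + 2 * r - 1)"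

lemma linear_slack_nonneg: "C \<ge> 0 \<Longrightarrow> linear_slack C \<ge> 0" using length_gt_1 by (simp add: linear_slack_def)

text \<open>Adding the linear term \<open>linear_slack C * t\<close>, which is negligible against
  \<open>t powr \<beta>\<close>, absorbs the error \<open>C * t\<close>.\<close>

lemma normalised_submean:
  fixes f :: "real \<Rightarrow> real"
  assumes sub: "\<And>t. t > 0 \<Longrightarrow> f t \<le> 2 * a\<^sup>2 * f (t / a) + 2 * r\<^sup>2 * f (t / r) + C * t"
  defines "g \<equiv> \<lambda>s. (f (exp (- s)) + linear_slack C * exp (- s)) * exp (\<beta> * s)"
  shows "g s \<le> (2 * a powr \<alpha>) * g (s - (- ln a)) + (2 * r powr \<alpha>) * g (s - (- ln r))"
proof -
  define t where "t = exp (- s)"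
  have t: "t > 0" by (simp add: t_def)
  have g: "g (s - (- ln c)) = (f (t / c) + linear_slack C * (t / c)) * exp (\<beta> * s) * c powr \<beta>" if "c > 0" for c
  proof -
    have "exp (- (s - (- ln c))) = t / c" using that by (simp add: t_def exp_diff exp_minus field_simps)
    moreover have "exp (\<beta> * (s - (- ln c))) = exp (\<beta> * s) * c powr \<beta>"
      using that by (simp add: powr_def exp_add[symmetric] algebra_simps)
    ultimately show ?thesis by (simp add: g_def)
  qed
  \<comment> \<open>The area factor c^2 splits into the weight c^\<alpha> and the factor c^\<beta>
    produced by moving the normalisation from scale t to t / c.\<close>
  have pw: "c powr \<alpha> * c powr \<beta> = c\<^sup>2" if "c > 0" for c :: real
    using that by (simp add: powr_add[symmetric] \<beta>_def)
  have "linear_slack C * (2 * a + 2 * r - 1) = C" using length_gt_1 by (simp add: linear_slack_def)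
  then have "C + linear_slack C = linear_slack C * (2 * a + 2 * r)" by (simp add: algebra_simps)
  then have "C * t + linear_slack C * t = linear_slack C * (2 * a + 2 * r) * t"
    by (simp only: distrib_right[symmetric])
  moreover have "2 * a\<^sup>2 * (f (t / a) + linear_slack C * (t / a)) + 2 * r\<^sup>2 * (f (t / r) + linear_slack C * (t / r))
      = 2 * a\<^sup>2 * f (t / a) + 2 * r\<^sup>2 * f (t / r) + linear_slack C * (2 * a + 2 * r) * t"
  proof -
    have "2 * c\<^sup>2 * (x + linear_slack C * (t / c)) = 2 * c\<^sup>2 * x + linear_slack C * (2 * c) * t" if "c > 0" for c x
      using that by (simp add: power2_eq_square distrib_left)
    then show ?thesis using a r by (simp add: algebra_simps)
  qed
  ultimately have "f t + linear_slack C * t \<le> 2 * a\<^sup>2 * (f (t / a) + linear_slack C * (t / a)) + 2 * r\<^sup>2 * (f (t / r) + linear_slack C * (t / r))"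
    using sub[OF t] by linarith
  then have "g s \<le> (2 * a\<^sup>2 * (f (t / a) + linear_slack C * (t / a)) + 2 * r\<^sup>2 * (f (t / r) + linear_slack C * (t / r))) * exp (\<beta> * s)"
    unfolding g_def t_def[symmetric] by (intro mult_right_mono) auto
  also have "\<dots> = (2 * a powr \<alpha>) * g (s - (- ln a)) + (2 * r powr \<alpha>) * g (s - (- ln r))"
    unfolding g[OF a(1)] g[OF r(1)] pw[OF a(1), symmetric] pw[OF r(1), symmetric]
    by (simp add: algebra_simps)
  finally show ?thesis .
qed

text \<open>For t \<ge> 1 the bound K is enough. For t < 1, in the variable s = -ln t, the submean
  property starts from the window [-W, 0], where t runs through [1, exp W]: there f is at most K and
  the slack at most \<open>linear_slack C * exp W\<close>.\<close>

lemma power_bound: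
  fixes f :: "real \<Rightarrow> real"
  assumes C: "C \<ge> 0" and f: "\<And>t. t > 0 \<Longrightarrow> 0 \<le> f t" "\<And>t. t > 0 \<Longrightarrow> f t \<le> K"
    and sub: "\<And>t. t > 0 \<Longrightarrow> f t \<le> 2 * a\<^sup>2 * f (t / a) + 2 * r\<^sup>2 * f (t / r) + C * t"
    and t: "t > 0"
  shows "f t \<le> (K + linear_slack C * exp (max (- ln a) (- ln r))) * t powr \<beta>"
proof -
  define W where "W = max (- ln a) (- ln r)"
  define M where "M = K + linear_slack C * exp W"
  have M: "M \<ge> K" "K \<ge> 0" using f[of 1] linear_slack_nonneg[OF C] by (auto simp: M_def)
  have "f t \<le> M * t powr \<beta>"
  proof (cases "t \<ge> 1")
    case True
    then have "t powr \<beta> \<ge> 1" using \<beta> by (simp add: ge_one_powr_ge_zero)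
    then have "M * 1 \<le> M * t powr \<beta>" using M by (intro mult_left_mono) auto
    then show ?thesis using f[OF t] M by linarith
  next
    case False
    define g where "g s = (f (exp (- s)) + linear_slack C * exp (- s)) * exp (\<beta> * s)" for s
    have "g s \<le> M" if "s \<ge> - W" for s
    proof (rule submean_bound_propagates[of "- ln a" "- ln r" "2 * a powr \<alpha>" "2 * r powr \<alpha>" "- W" g M s])
      show "g s \<le> (2 * a powr \<alpha>) * g (s - (- ln a)) + (2 * r powr \<alpha>) * g (s - (- ln r))" for s
        unfolding g_def by (rule normalised_submean) (use sub in blast)
      show "g s \<le> M" if "- W \<le> s" "s \<le> - W + max (- ln a) (- ln r)" for s
      proof -
        have s: "s \<le> 0" "- s \<le> W" using that by (auto simp: W_def)
        have "f (exp (- s)) + linear_slack C * exp (- s) \<le> M"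
          unfolding M_def using f(2)[of "exp (- s)"] s linear_slack_nonneg[OF C]
          by (intro add_mono mult_left_mono) auto
        moreover have "exp (\<beta> * s) \<le> 1" using s \<beta> by (simp add: mult_nonneg_nonpos)
        ultimately show ?thesis unfolding g_def
          using mult_mono[of "f (exp (- s)) + linear_slack C * exp (- s)" M "exp (\<beta> * s)" 1] M by simp
      qed
    qed (use a r dim that in auto)
    moreover have "- W \<le> - ln t"
    proof -
      have "ln t \<le> 0" "ln a \<le> 0" using False t a by auto
      then show ?thesis by (simp add: W_def)
    qed
    ultimately have "g (- ln t) \<le> M" by blast
    then have "(f t + linear_slack C * t) * exp (\<beta> * - ln t) \<le> M" using t by (simp add: g_def)
    then have "f t + linear_slack C * t \<le> M * t powr \<beta>"
      using t by (simp add: powr_def exp_minus field_simps)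
    moreover have "linear_slack C * t \<ge> 0" using linear_slack_nonneg[OF C] t by simp
    ultimately show ?thesis by linarith
  qed
  then show ?thesis by (simp add: M_def W_def)
qed

text \<open>By \<open>power_bound\<close> the increment hypothesis becomes a Hoelder estimate of
  order \<beta>, whose scale is cancelled exactly by the normalisation. Hence the normalised
  function of s = -ln t is bounded and uniformly continuous, as the one-sided renewal theorem
  requires.\<close>

lemma tendsto_of_approximate_subsimilarity:
  fixes f :: "real \<Rightarrow> real"
  assumes irr: "ln a / ln r \<notin> \<rat>" and C: "C \<ge> 0"
    and f: "\<And>t. t > 0 \<Longrightarrow> 0 \<le> f t" "\<And>t. t > 0 \<Longrightarrow> f t \<le> K"
    and cont: "\<And>s t. 0 < s \<Longrightarrow> s < t \<Longrightarrow> \<bar>f t - f s\<bar> \<le> f (t - s)"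
    and sub: "\<And>t. t > 0 \<Longrightarrow> f t \<le> 2 * a\<^sup>2 * f (t / a) + 2 * r\<^sup>2 * f (t / r) + C * t"
  shows "\<exists>l. ((\<lambda>t. f t / t powr \<beta>) \<longlongrightarrow> l) (at_right 0)"
proof -
  define M where "M = K + linear_slack C * exp (max (- ln a) (- ln r))"
  have M: "M \<ge> 0" "\<And>t. t > 0 \<Longrightarrow> f t \<le> M * t powr \<beta>"
    using power_bound[OF C f sub] f[of 1] linear_slack_nonneg[OF C] by (auto simp: M_def)
  define g where "g s = (f (exp (- s)) + linear_slack C * exp (- s)) * exp (\<beta> * s)" for s
  define G where "G s = f (exp (- s)) * exp (\<beta> * s)" for s
  \<comment> \<open>A modulus of continuity for \<open>g\<close>; the three terms come from the
    increment of f, from the change of exp (\<beta> s), and from the slack.\<close>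
  define k where "k d = M * d powr \<beta> + M * \<beta> * d + linear_slack C * d" for d
  have g_G: "g s = G s + linear_slack C * exp (- ((1 - \<beta>) * s))" for s
    by (simp add: g_def G_def algebra_simps exp_add[symmetric])
  have fexp: "f (exp (- s)) \<le> M * exp (- \<beta> * s)" for s
    using M(2)[of "exp (- s)"] by (simp add: powr_def)
  have step: "\<bar>g s' - g s\<bar> \<le> k (s' - s)" if s: "0 \<le> s" "s < s'" for s s'
  proof -
    define d where "d = s' - s"
    have d: "d > 0" using s by (simp add: d_def)
    have e: "exp (- s') = exp (- s) * exp (- d)" "exp (\<beta> * s) = exp (\<beta> * s') * exp (- (\<beta> * d))"
      by (simp_all add: d_def exp_add[symmetric] algebra_simps)
    have df: "\<bar>f (exp (- s)) - f (exp (- s'))\<bar> \<le> M * (exp (- s) * d) powr \<beta>"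
    proof -
      have pos: "exp (- s) - exp (- s') > 0" using s by simp
      have "\<bar>f (exp (- s)) - f (exp (- s'))\<bar> \<le> f (exp (- s) - exp (- s'))"
        using cont[of "exp (- s')" "exp (- s)"] s by simp
      also have "\<dots> \<le> M * (exp (- s) - exp (- s')) powr \<beta>" by (rule M(2)[OF pos])
      also have "\<dots> \<le> M * (exp (- s) * d) powr \<beta>"
      proof (intro mult_left_mono powr_mono2)
        have "exp (- s) - exp (- s') = exp (- s) * (1 - exp (- d))" by (simp add: e algebra_simps)
        also have "\<dots> \<le> exp (- s) * d" by (intro mult_left_mono one_minus_exp_le) auto
        finally show "exp (- s) - exp (- s') \<le> exp (- s) * d" .
      qed (use pos \<beta> M in auto)
      finally show ?thesis .
    qed
    have "G s' - G s = - (f (exp (- s)) - f (exp (- s'))) * exp (\<beta> * s)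
        + f (exp (- s')) * (exp (\<beta> * s') - exp (\<beta> * s))"
      by (simp add: G_def algebra_simps)
    also have "\<bar>\<dots>\<bar> \<le> \<bar>f (exp (- s)) - f (exp (- s'))\<bar> * exp (\<beta> * s)
        + f (exp (- s')) * (exp (\<beta> * s') - exp (\<beta> * s))"
      using f[of "exp (- s')"] s \<beta> by (intro order_trans[OF abs_triangle_ineq]) (simp add: abs_mult)
    also have "\<dots> \<le> M * d powr \<beta> + M * (\<beta> * d)"
    proof (intro add_mono)
      have "\<bar>f (exp (- s)) - f (exp (- s'))\<bar> * exp (\<beta> * s) \<le> M * (exp (- s) * d) powr \<beta> * exp (\<beta> * s)"
        by (intro mult_right_mono df) auto
      also have "\<dots> = M * d powr \<beta>"
        using d by (simp add: powr_mult) (simp add: powr_def exp_add[symmetric])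
      finally show "\<bar>f (exp (- s)) - f (exp (- s'))\<bar> * exp (\<beta> * s) \<le> M * d powr \<beta>" .
      have "f (exp (- s')) * (exp (\<beta> * s') - exp (\<beta> * s))
          \<le> M * exp (- \<beta> * s') * (exp (\<beta> * s') - exp (\<beta> * s))"
        using s \<beta> by (intro mult_right_mono fexp) auto
      also have "\<dots> = M * (1 - exp (- (\<beta> * d)))"
        unfolding e by (simp add: algebra_simps exp_add[symmetric] exp_minus)
      also have "\<dots> \<le> M * (\<beta> * d)" by (intro mult_left_mono one_minus_exp_le M)
      finally show "f (exp (- s')) * (exp (\<beta> * s') - exp (\<beta> * s)) \<le> M * (\<beta> * d)" .
    qed
    finally have G: "\<bar>G s' - G s\<bar> \<le> M * d powr \<beta> + M * (\<beta> * d)" .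
    have "exp (- ((1 - \<beta>) * s)) - exp (- ((1 - \<beta>) * s')) = exp (- ((1 - \<beta>) * s)) * (1 - exp (- ((1 - \<beta>) * d)))"
      by (simp add: d_def algebra_simps exp_add[symmetric])
    also have "\<dots> \<le> 1 * ((1 - \<beta>) * d)"
      using s \<beta> d by (intro mult_mono one_minus_exp_le) auto
    also have "\<dots> \<le> d" using \<beta> d by (simp add: algebra_simps)
    finally have "\<bar>exp (- ((1 - \<beta>) * s')) - exp (- ((1 - \<beta>) * s))\<bar> \<le> d" using s \<beta> by simp
    then have "\<bar>linear_slack C * exp (- ((1 - \<beta>) * s')) - linear_slack C * exp (- ((1 - \<beta>) * s))\<bar> \<le> linear_slack C * d"
      using linear_slack_nonneg[OF C] by (simp add: right_diff_distrib[symmetric] abs_mult mult_left_mono)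
    with G show ?thesis unfolding g_G k_def d_def[symmetric] by (simp add: algebra_simps)
  qed
  have "uniformly_continuous_on {0..} g"
    unfolding uniformly_continuous_on_def dist_real_def
  proof (intro allI impI)
    fix e :: real assume e: "e > 0"
    have "(k \<longlongrightarrow> M * 0 + M * \<beta> * 0 + linear_slack C * 0) (at_right 0)"
      unfolding k_def
      by (intro tendsto_intros tendsto_zero_powrI[OF _ tendsto_const])
         (use \<beta> in \<open>auto intro: tendsto_ident_at simp: eventually_at_filter\<close>)
    then have "eventually (\<lambda>d. k d < e) (at_right 0)"
      using e by (auto dest: order_tendstoD(2)[of _ _ _ e])
    then obtain \<delta> where \<delta>: "\<delta> > 0" "\<And>d. 0 < d \<Longrightarrow> d < \<delta> \<Longrightarrow> k d < e"
      by (auto simp: eventually_at_right_field)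
    show "\<exists>d>0. \<forall>x\<in>{0..}. \<forall>x'\<in>{0..}. \<bar>x' - x\<bar> < d \<longrightarrow> \<bar>g x' - g x\<bar> < e"
    proof (intro exI[of _ \<delta>] conjI ballI impI \<delta>(1))
      fix x x' :: real assume "x \<in> {0..}" "x' \<in> {0..}" "\<bar>x' - x\<bar> < \<delta>"
      then show "\<bar>g x' - g x\<bar> < e"
        using step[of x x'] step[of x' x] \<delta>(2)[of "x' - x"] \<delta>(2)[of "x - x'"] e
        by (cases x x' rule: linorder_cases) (auto simp: abs_minus_commute)
    qed
  qed
  moreover have "\<bar>g s\<bar> \<le> M + linear_slack C" if "s \<ge> 0" for s
  proof -
    have "0 \<le> G s" using f[of "exp (- s)"] by (simp add: G_def)
    moreover have "G s \<le> M * exp (- \<beta> * s) * exp (\<beta> * s)"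
      unfolding G_def by (intro mult_right_mono fexp) auto
    moreover have "M * exp (- \<beta> * s) * exp (\<beta> * s) = M" by (simp add: exp_add[symmetric])
    moreover have "0 \<le> linear_slack C * exp (- ((1 - \<beta>) * s))" using linear_slack_nonneg[OF C] by simp
    moreover have "linear_slack C * exp (- ((1 - \<beta>) * s)) \<le> linear_slack C * 1"
      using linear_slack_nonneg[OF C] that \<beta> by (intro mult_left_mono) auto
    ultimately show ?thesis unfolding g_G by linarith
  qed
  moreover have "g s \<le> (2 * a powr \<alpha>) * g (s - (- ln a)) + (2 * r powr \<alpha>) * g (s - (- ln r))" for s
    unfolding g_def by (rule normalised_submean) (use sub in blast)
  ultimately obtain l where l: "(g \<longlongrightarrow> l) at_top"
    using submean_tendsto[of "- ln a" "- ln r" "2 * a powr \<alpha>" "2 * r powr \<alpha>" 0 g "M + linear_slack C"]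
      a r irr dim by auto
  \<comment> \<open>As \<beta> < 1 the normalised slack vanishes, so removing it does not change the
    limit.\<close>
  have "((\<lambda>s. exp (- ((1 - \<beta>) * s))) \<longlongrightarrow> 0) at_top"
    using \<beta> by (intro filterlim_compose[OF exp_at_bot] filterlim_compose[OF filterlim_uminus_at_bot_at_top]
        filterlim_tendsto_pos_mult_at_top[OF tendsto_const _ filterlim_ident]) auto
  then have "((\<lambda>s. g s - linear_slack C * exp (- ((1 - \<beta>) * s))) \<longlongrightarrow> l - linear_slack C * 0) at_top"
    by (intro tendsto_intros l)
  then have "(G \<longlongrightarrow> l) at_top" by (simp add: g_G)
  moreover have "filterlim (\<lambda>t. - ln t) at_top (at_right (0::real))"
    using ln_at_0 by (simp add: filterlim_uminus_at_top)
  ultimately have "((\<lambda>t. G (- ln t)) \<longlongrightarrow> l) (at_right 0)" by (rule filterlim_compose)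
  moreover have "eventually (\<lambda>t. G (- ln t) = f t / t powr \<beta>) (at_right (0::real))"
    using eventually_at_right_less[of "0::real"]
    by eventually_elim (simp add: G_def powr_def exp_minus field_simps)
  ultimately have "((\<lambda>t. f t / t powr \<beta>) \<longlongrightarrow> l) (at_right 0)" by (rule Lim_transform_eventually)
  then show ?thesis ..
qed

end

section \<open>Self-similarity of the Koch region\<close>

abbreviation \<zeta> :: complex where "\<zeta> \<equiv> cis (pi / 3)"

lemma zeta_eq: "\<zeta> = Complex (1 / 2) (sqrt 3 / 2)"
  by (simp add: complex_eq_iff cos_60 sin_60)

lemma zeta_square: "\<zeta> * \<zeta> = \<zeta> - 1"
  by (simp add: zeta_eq complex_eq_iff)

lemma cis_minus_pi_third: "cis (- pi / 3) = 1 - \<zeta>"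
  by (simp add: complex_eq_iff cos_60 sin_60)

lemma one_minus_zeta_times_zeta: "(1 - \<zeta>) * \<zeta> = 1"
  by (simp add: algebra_simps zeta_square)

lemma cmod_one_minus_zeta: "cmod (1 - \<zeta>) = 1"
  unfolding cis_minus_pi_third[symmetric] by (rule norm_cis)

lemma divide_one_minus_zeta: "z / (1 - \<zeta>) = \<zeta> * z"
proof -
  have "1 - \<zeta> \<noteq> 0" using one_minus_zeta_times_zeta by auto
  then show ?thesis
    by (metis nonzero_mult_div_cancel_left one_minus_zeta_times_zeta mult.assoc mult_1)
qed

lemma divide_zeta: "z / \<zeta> = (1 - \<zeta>) * z"
  by (metis cis_neq_zero mult.assoc mult.commute mult_1 nonzero_mult_div_cancel_left one_minus_zeta_times_zeta)

text \<open>The orientation-preserving similarity taking the unit segment to s. Orientation matters: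
  the outward side stays on the right.\<close>

definition place :: "complex \<times> complex \<Rightarrow> complex \<Rightarrow> complex" where
  "place s z = fst s + (snd s - fst s) * z"

lemma place_0 [simp]: "place s 0 = fst s" and place_1 [simp]: "place s 1 = snd s"
  and place_unit [simp]: "place (0, 1) z = z"
  by (simp_all add: place_def)

lemma place_place: "place (place s x, place s y) z = place s (place (x, y) z)"
  by (simp add: place_def algebra_simps)

lemma place_diff: "place s x - place s y = (snd s - fst s) * (x - y)"
  by (simp add: place_def algebra_simps)

lemma continuous_on_place: "continuous_on S (place s)"
  unfolding place_def by (intro continuous_intros)

lemma place_convex_hull: "place s ` (convex hull S) = convex hull (place s ` S)"
proof -
  have "place s ` X = (+) (fst s) ` (*) (snd s - fst s) ` X" for X
    by (auto simp: place_def image_image)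
  moreover have "linear ((*) (snd s - fst s))"
    by (simp add: bounded_linear.linear bounded_linear_mult_right)
  ultimately show ?thesis
    by (simp only: convex_hull_linear_image convex_hull_translation)
qed

definition unit_triangle :: "complex set" where "unit_triangle = convex hull {0, 1, \<zeta>}"

lemma compact_unit_triangle: "compact unit_triangle" and convex_unit_triangle: "convex unit_triangle"
  by (simp_all add: unit_triangle_def compact_convex_hull)

lemma interior_unit_triangle: "interior unit_triangle \<noteq> {}"
proof -
  have "\<not> collinear {0, 1, \<zeta>}"
    by (auto simp: collinear_lemma complex_eq_iff sin_60)
  from interior_convex_hull_3_minimal[OF this]
  have "(1 / 3) *\<^sub>R 0 + (1 / 3) *\<^sub>R 1 + (1 / 3) *\<^sub>R \<zeta> \<in> interior unit_triangle"
    unfolding unit_triangle_def by (auto intro!: exI[of _ "1 / 3 :: real"])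
  then show ?thesis by blast
qed

text \<open>The refinement started from a single segment and kept as a set, which isolates one side
  of the snowflake.\<close>

fun koch_descendants :: "real \<Rightarrow> nat \<Rightarrow> complex \<times> complex \<Rightarrow> (complex \<times> complex) set" where
  "koch_descendants \<eta> 0 s = {s}"
| "koch_descendants \<eta> (Suc n) s = (\<Union>t\<in>koch_descendants \<eta> n s. set (koch_refine \<eta> t))"

text \<open>Splitting off the first generation instead of the last exposes the
  self-similarity.\<close>

lemma koch_descendants_Suc:
  "koch_descendants \<eta> (Suc n) s = (\<Union>t\<in>set (koch_refine \<eta> s). koch_descendants \<eta> n t)"
proof (induction n)
  case (Suc n)
  have "koch_descendants \<eta> (Suc (Suc n)) s = (\<Union>t\<in>koch_descendants \<eta> (Suc n) s. set (koch_refine \<eta> t))"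
    by simp
  then show ?case unfolding Suc by simp
qed simp

lemma set_koch_segs:
  "set (koch_segs \<eta> n) = (\<Union>s\<in>{(0, 1), (1, \<zeta>), (\<zeta>, 0)}. koch_descendants \<eta> n s)"
  by (induction n) auto

text \<open>No closure is taken: as a countable union of triangles the region is Borel and satisfies
  its self-similarity as an exact set equation.\<close>

definition koch_region :: "real \<Rightarrow> complex \<times> complex \<Rightarrow> complex set" where
  "koch_region \<eta> s = (\<Union>n. \<Union>t\<in>koch_descendants \<eta> n s. koch_tri \<eta> t)"

lemma koch_region_rec:
  "koch_region \<eta> s = koch_tri \<eta> s \<union> (\<Union>t\<in>set (koch_refine \<eta> s). koch_region \<eta> t)"
proof -
  have "(\<Union>n. F n) = F 0 \<union> (\<Union>n. F (Suc n))" for F :: "nat \<Rightarrow> complex set"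
    by (subst UNIV_nat_eq) auto
  from this[of "\<lambda>n. \<Union>t\<in>koch_descendants \<eta> n s. koch_tri \<eta> t"]
  have "koch_region \<eta> s = (\<Union>t\<in>koch_descendants \<eta> 0 s. koch_tri \<eta> t) \<union>
      (\<Union>n. \<Union>t\<in>koch_descendants \<eta> (Suc n) s. koch_tri \<eta> t)"
    unfolding koch_region_def .
  then show ?thesis
    unfolding koch_region_def koch_descendants_Suc by auto
qed

locale koch =
  fixes \<eta> :: real
  assumes eta: "\<eta> > 1"
begin

definition "a = (\<eta> - 1) / (2 * \<eta>)"
definition "r = 1 / \<eta>"

lemma a: "0 < a" "a < 1" and r: "0 < r" "r < 1" and ar: "2 * a + r = 1"
  using eta by (auto simp: a_def r_def field_simps)

lemma ar': "2 * complex_of_real a + complex_of_real r = 1"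
  using arg_cong[OF ar, of complex_of_real] by simp

lemma koch_pts_place:
  "koch_pts \<eta> s = (place s (of_real a), place s (of_real a + of_real r * (1 - \<zeta>)), place s (of_real a + of_real r))"
proof -
  obtain u v where s: "s = (u, v)" by (cases s)
  have "complex_of_real a + of_real r = 1 - of_real a" using ar' by (simp add: eq_diff_eq)
  then have p3: "v - (v - u) * of_real a = u + (v - u) * (of_real a + of_real r)"
    by (simp only:) (simp add: algebra_simps)
  show ?thesis
    unfolding koch_pts_def Let_def s fst_conv snd_conv a_def[symmetric] p3 cis_minus_pi_third place_def
    by (simp add: algebra_simps)
qed

definition "p1 = complex_of_real a"
definition "p2 = complex_of_real a + complex_of_real r * (1 - \<zeta>)"
definition "p3 = complex_of_real a + complex_of_real r"

text \<open>\<open>place (p1, p2)\<close> sends 0, 1, \<open>\<zeta>\<close> to p1, p2, p3, so the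
  bump lies on its edge from p1 to p2 exactly as the initial triangle lies on the side from 0 to
  1.\<close>

lemma koch_tri_place: "koch_tri \<eta> s = place s ` place (p1, p2) ` unit_triangle"
proof -
  have "place (p1, p2) \<zeta> = p3"
    by (simp add: place_def p1_def p2_def p3_def mult.assoc one_minus_zeta_times_zeta)
  then have "place (p1, p2) ` unit_triangle = convex hull {p1, p2, p3}"
    by (simp add: unit_triangle_def place_convex_hull)
  then show ?thesis
    by (simp add: koch_tri_def koch_pts_place place_convex_hull p1_def p2_def p3_def)
qed

lemma koch_refine_place:
  "koch_refine \<eta> s = map (\<lambda>t. (place s (fst t), place s (snd t))) [(0, p1), (p1, p2), (p2, p3), (p3, 1)]"
  by (simp add: koch_refine_def koch_pts_place p1_def p2_def p3_def)

lemma koch_descendants_place: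
  "koch_descendants \<eta> n (place s x, place s y) =
    (\<lambda>t. (place s (fst t), place s (snd t))) ` koch_descendants \<eta> n (x, y)"
proof (induction n)
  case (Suc n)
  then show ?case by (simp add: koch_refine_place place_place image_UN)
qed simp

lemma koch_region_place: "koch_region \<eta> s = place s ` koch_region \<eta> (0, 1)"
proof -
  have "koch_descendants \<eta> n s = (\<lambda>t. (place s (fst t), place s (snd t))) ` koch_descendants \<eta> n (0, 1)" for n
    using koch_descendants_place[of n s 0 1] by simp
  then show ?thesis
    unfolding koch_region_def by (simp add: image_UN koch_tri_place place_place[abs_def] image_comp o_def)
qed

abbreviation "A \<equiv> koch_region \<eta> (0, 1)"
abbreviation "D \<equiv> place (p1, p2) ` unit_triangle"

lemma A_rec:
  "A = D \<union> (place (0, p1) ` A \<union> place (p1, p2) ` A \<union> place (p2, p3) ` A \<union> place (p3, 1) ` A)"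
  by (subst koch_region_rec)
     (simp add: koch_tri_place koch_refine_place koch_region_place[of "(0, p1)"]
       koch_region_place[of "(p1, p2)"] koch_region_place[of "(p2, p3)"] koch_region_place[of "(p3, 1)"] Un_assoc)

lemma snowflake_eq:
  "koch_snowflake \<eta> = interior (closure (A \<union> place (1, \<zeta>) ` A \<union> place (\<zeta>, 0) ` A \<union> unit_triangle))"
proof -
  have "(\<Union>n. \<Union>s\<in>set (koch_segs \<eta> n). koch_tri \<eta> s) = A \<union> koch_region \<eta> (1, \<zeta>) \<union> koch_region \<eta> (\<zeta>, 0)"
    unfolding set_koch_segs koch_region_def by auto
  then show ?thesis
    unfolding koch_snowflake_def unit_triangle_def[symmetric]
    by (simp add: koch_region_place[of "(1, \<zeta>)"] koch_region_place[of "(\<zeta>, 0)"] Un_commute Un_assoc)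
qed

lemma slopes:
  "p1 = of_real a" "p2 - p1 = of_real r * (1 - \<zeta>)" "p3 - p2 = of_real r * \<zeta>" "1 - p3 = of_real a"
  "cmod p1 = a" "cmod (p2 - p1) = r" "cmod (p3 - p2) = r" "cmod (1 - p3) = a"
proof -
  show *: "p1 = of_real a" "p2 - p1 = of_real r * (1 - \<zeta>)" "p3 - p2 = of_real r * \<zeta>" "1 - p3 = of_real a"
    using ar' by (simp_all add: p1_def p2_def p3_def algebra_simps)
  show "cmod p1 = a" "cmod (p2 - p1) = r" "cmod (p3 - p2) = r" "cmod (1 - p3) = a"
    using arg_cong[OF *(1), of cmod] arg_cong[OF *(2), of cmod] arg_cong[OF *(3), of cmod]
      arg_cong[OF *(4), of cmod] a r
    by (simp_all add: norm_mult cmod_one_minus_zeta)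
qed

lemma compact_koch_tri: "compact (koch_tri \<eta> s)"
  unfolding koch_tri_place
  by (intro compact_continuous_image continuous_on_place compact_unit_triangle)

lemma finite_koch_descendants: "finite (koch_descendants \<eta> n s)"
  by (induction n) auto

lemma A_borel [measurable]: "A \<in> sets borel"
  unfolding koch_region_def
  by (intro sets.countable_UN image_subsetI sets.finite_UN finite_koch_descendants)
     (auto intro: borel_compact compact_koch_tri)

text \<open>With m the larger ratio, R = 1 / (1 - m) sums the geometric series of segment lengths.
  The identity 1 + R m = R gives the invariant that the displacement of the initial point plus R
  times the current length stays at most R times the original length.\<close>

lemma bounded_A: "bounded A"
proof -
  define m where "m = max a r"
  have m: "0 < m" "m < 1" using a r by (auto simp: m_def)
  define R where "R = 1 / (1 - m)"
  have R: "R \<ge> 1" "1 + R * m = R" using m by (auto simp: R_def field_simps)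
  define len where "len s = cmod (snd s - fst s)" for s :: "complex \<times> complex"
  have step: "dist (fst t) (fst s) + R * len t \<le> R * len s" if t: "t \<in> set (koch_refine \<eta> s)" for s t
  proof -
    obtain x y where t': "t = (place s x, place s y)"
      and xy: "(x, y) \<in> set [(0, p1), (p1, p2), (p2, p3), (p3, 1)]"
      using t unfolding koch_refine_place set_map by force
    have "cmod p2 \<le> a + r * 1"
      unfolding p2_def by (rule norm_triangle_le) (use a r cmod_one_minus_zeta in \<open>simp add: norm_mult\<close>)
    moreover have "cmod p3 \<le> a + r"
      unfolding p3_def by (rule norm_triangle_le) (use a r in simp)
    ultimately have x: "cmod x \<le> 1" and y: "cmod (y - x) \<le> m"
      using xy slopes ar a r by (auto simp: m_def)
    have "dist (fst t) (fst s) = len s * cmod x"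
      using place_diff[of s x 0] by (simp add: t' dist_norm len_def norm_mult)
    moreover have "len t = len s * cmod (y - x)"
      by (simp add: t' len_def place_diff norm_mult)
    ultimately have "dist (fst t) (fst s) + R * len t \<le> len s * 1 + R * (len s * m)"
      using x y R by (auto intro!: add_mono mult_left_mono mult_left_le simp: len_def)
    also have "\<dots> = len s * (1 + R * m)" by (simp add: algebra_simps)
    finally show ?thesis by (simp only: R(2) mult.commute)
  qed
  have desc: "dist (fst t) (fst s) + R * len t \<le> R * len s" if "t \<in> koch_descendants \<eta> n s" for n s t
    using that
  proof (induction n arbitrary: t)
    case (Suc n)
    then obtain t' where t': "t' \<in> koch_descendants \<eta> n s" "t \<in> set (koch_refine \<eta> t')" by auto
    show ?case using Suc.IH[OF t'(1)] step[OF t'(2)] dist_triangle[of "fst t" "fst s" "fst t'"] by simp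
  qed simp
  have tri: "bounded D" by (intro compact_imp_bounded compact_continuous_image continuous_on_place compact_unit_triangle)
  then obtain b where b: "\<And>z. z \<in> D \<Longrightarrow> cmod z \<le> b" by (auto simp: bounded_iff)
  define c where "c = max b 0"
  have "cmod z \<le> R * 1 + c * (R * 1)" if z: "z \<in> A" for z
  proof -
    obtain n t w where t: "t \<in> koch_descendants \<eta> n (0, 1)" and w: "w \<in> D" "z = place t w"
      using z unfolding koch_region_def koch_tri_place by blast
    have d: "cmod (fst t) + R * len t \<le> R * 1" using desc[OF t] by (simp add: len_def)
    have R0: "R * len t \<ge> 0" "len t \<le> R * len t" using R mult_right_mono[of 1 R "len t"] by (auto simp: len_def)
    have "cmod z \<le> cmod (fst t) + len t * cmod w"
      unfolding w place_def len_def norm_mult[symmetric] by (rule norm_triangle_ineq)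
    also have "\<dots> \<le> R * 1 + (R * 1) * c"
    proof (intro add_mono mult_mono)
      show "cmod (fst t) \<le> R * 1" "len t \<le> R * 1" "0 \<le> R * 1"
        using d R0 R norm_ge_zero[of "fst t"] by linarith+
    qed (use b[OF w(1)] in \<open>auto simp: c_def\<close>)
    finally show ?thesis by (simp add: algebra_simps)
  qed
  then show ?thesis by (auto simp: bounded_iff)
qed

lemma fmeasurable_A: "A \<in> fmeasurable lborel"
  using emeasure_bounded_finite[OF bounded_A] by (auto simp: fmeasurable_def)

end

section \<open>Subadditivity defects\<close>

lemma zeta_mult_one_minus [simp]: "\<zeta> * ((1 - \<zeta>) * h) = h"
  by (metis mult.assoc mult.commute mult_1 one_minus_zeta_times_zeta)

lemma zeta_cube [simp]: "\<zeta> * (\<zeta> * (\<zeta> * h)) = - h"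
proof -
  have "\<zeta> * (\<zeta> * \<zeta>) = - 1" using one_minus_zeta_times_zeta by (simp add: zeta_square algebra_simps)
  then show ?thesis by (metis mult.assoc mult_minus1)
qed

lemma
  assumes "x \<noteq> y" "X \<in> fmeasurable lborel"
  shows fmeasurable_place: "place (x, y) ` X \<in> fmeasurable lborel"
    and measure_place: "measure lborel (place (x, y) ` X) = (cmod (y - x))\<^sup>2 * measure lborel X"
    and shift_loss_place: "shift_loss (place (x, y) ` X) h = (cmod (y - x))\<^sup>2 * shift_loss X (h / (y - x))"
  using fmeasurable_similarity[of "y - x" X x] measure_similarity[of "y - x" X x]
    shift_loss_similarity[of "y - x" X x h] assms
  by (simp_all add: place_def[abs_def])

lemma fmeasurable_unit_triangle: "unit_triangle \<in> fmeasurable lborel"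
  by (simp add: fmeasurable_compact compact_unit_triangle)

definition triangle_const :: real where
  "triangle_const = (SOME C. C \<ge> 0 \<and> (\<forall>h. shift_loss unit_triangle h \<le> C * cmod h))"

lemma triangle_const: "triangle_const \<ge> 0" "shift_loss unit_triangle h \<le> triangle_const * cmod h"
proof -
  have "\<exists>C\<ge>0. \<forall>h. shift_loss unit_triangle h \<le> C * cmod h"
    by (rule shift_loss_convex_le[OF compact_unit_triangle convex_unit_triangle interior_unit_triangle]) blast
  then have "triangle_const \<ge> 0 \<and> (\<forall>h. shift_loss unit_triangle h \<le> triangle_const * cmod h)"
    unfolding triangle_const_def by (rule someI2_ex) blast
  then show "triangle_const \<ge> 0" "shift_loss unit_triangle h \<le> triangle_const * cmod h" by auto
qed

context koch
begin

definition region_loss :: "complex \<Rightarrow> real" where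
  "region_loss h = shift_loss A h"
text \<open>Since the loss is even, the three rotations below represent all six multiples of
  \<open>pi / 3\<close>, so that their sum is invariant under multiplication by \<open>\<zeta>\<close>.\<close>

definition orbit_loss :: "complex \<Rightarrow> real" where
  "orbit_loss h = region_loss h + region_loss (\<zeta> * h) + region_loss (\<zeta> * (\<zeta> * h))"
text \<open>The failure of additivity over the four copies, with the bump left out. Dividing a shift
  by 1 - \<open>\<zeta>\<close> is multiplying it by \<open>\<zeta>\<close>, and conversely, which
  gives the arguments of the central terms.\<close>

definition defect :: "complex \<Rightarrow> real" where
  "defect h = 2 * a\<^sup>2 * region_loss (h / a) + r\<^sup>2 * region_loss (\<zeta> * (h / r))
    + r\<^sup>2 * region_loss ((1 - \<zeta>) * (h / r)) - region_loss h"
text \<open>The failure of additivity at one corner of the snowflake. The initial triangle is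
  included so that the union matches the central part of \<open>A\<close>, bump included.\<close>

definition pair_defect :: "complex \<Rightarrow> real" where
  "pair_defect h = region_loss h + shift_loss (place (1, \<zeta>) ` A) h + shift_loss unit_triangle h
  - shift_loss (A \<union> place (1, \<zeta>) ` A \<union> unit_triangle) h"

lemma region_loss_nonneg [simp]: "0 \<le> region_loss h" by (simp add: region_loss_def)

lemma region_loss_minus [simp]: "region_loss (- h) = region_loss h"
  unfolding region_loss_def by (rule shift_loss_minus[OF fmeasurable_A])

lemma orbit_loss_zeta: "orbit_loss (\<zeta> * h) = orbit_loss h"
  by (simp add: orbit_loss_def)

lemma orbit_loss_one_minus_zeta: "orbit_loss ((1 - \<zeta>) * h) = orbit_loss h"
  using orbit_loss_zeta[of "(1 - \<zeta>) * h"] by simp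

lemma distinct: "0 \<noteq> p1" "p1 \<noteq> p2" "p2 \<noteq> p3" "p3 \<noteq> 1"
  using slopes(5-8) a r by auto

lemma one_neq_zeta: "1 \<noteq> \<zeta>" using cmod_one_minus_zeta by auto

lemma shift_loss_copies:
  fixes h :: complex
  shows "shift_loss (place (0, p1) ` A) h = a\<^sup>2 * region_loss (h / a)"
  "shift_loss (place (p1, p2) ` A) h = r\<^sup>2 * region_loss (\<zeta> * (h / r))"
  "shift_loss (place (p2, p3) ` A) h = r\<^sup>2 * region_loss ((1 - \<zeta>) * (h / r))"
  "shift_loss (place (p3, 1) ` A) h = a\<^sup>2 * region_loss (h / a)"
proof -
  have "h / (of_real r * (1 - \<zeta>)) = \<zeta> * (h / r)" "h / (of_real r * \<zeta>) = (1 - \<zeta>) * (h / r)"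
    by (simp_all only: divide_divide_eq_left[symmetric] divide_one_minus_zeta divide_zeta)
  then show "shift_loss (place (0, p1) ` A) h = a\<^sup>2 * region_loss (h / a)"
    "shift_loss (place (p1, p2) ` A) h = r\<^sup>2 * region_loss (\<zeta> * (h / r))"
    "shift_loss (place (p2, p3) ` A) h = r\<^sup>2 * region_loss ((1 - \<zeta>) * (h / r))"
    "shift_loss (place (p3, 1) ` A) h = a\<^sup>2 * region_loss (h / a)"
    using shift_loss_place[OF distinct(1) fmeasurable_A, of h] shift_loss_place[OF distinct(2) fmeasurable_A, of h]
      shift_loss_place[OF distinct(3) fmeasurable_A, of h] shift_loss_place[OF distinct(4) fmeasurable_A, of h]
      slopes a r
    by (simp_all add: region_loss_def norm_mult cmod_one_minus_zeta)
qed

lemmas fmeasurable_copies =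
  fmeasurable_place[OF distinct(1) fmeasurable_A] fmeasurable_place[OF distinct(2) fmeasurable_A]
  fmeasurable_place[OF distinct(3) fmeasurable_A] fmeasurable_place[OF distinct(4) fmeasurable_A]
  fmeasurable_place[OF distinct(2) fmeasurable_unit_triangle]

lemma shift_loss_D: "shift_loss D h \<le> triangle_const * cmod h"
proof -
  have "shift_loss D h = r\<^sup>2 * shift_loss unit_triangle (h / (p2 - p1))"
    using shift_loss_place[OF distinct(2) fmeasurable_unit_triangle, of h] slopes by simp
  also have "\<dots> \<le> r\<^sup>2 * (triangle_const * cmod (h / (p2 - p1)))"
    by (intro mult_left_mono triangle_const) auto
  also have "\<dots> = r * (triangle_const * cmod h)"
    using slopes r by (simp add: norm_divide power2_eq_square)
  also have "\<dots> \<le> 1 * (triangle_const * cmod h)"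
    using r triangle_const by (intro mult_right_mono) auto
  finally show ?thesis by simp
qed

text \<open>Only the outer copies are split off. The central pair and its bump stay one set, so that
  \<open>defect\<close> can be compared from below with the defect of that set alone.\<close>

lemma region_loss_le_central:
  fixes h :: complex
  shows "region_loss h \<le> 2 * a\<^sup>2 * region_loss (h / a) + shift_loss (place (p1, p2) ` A \<union> place (p2, p3) ` A \<union> D) h"
proof -
  note fm = fmeasurable_copies
  have "A = place (0, p1) ` A \<union> (place (p3, 1) ` A \<union> (place (p1, p2) ` A \<union> place (p2, p3) ` A \<union> D))"
    using A_rec by auto
  then have "region_loss h = shift_loss (place (0, p1) ` A \<union> (place (p3, 1) ` A \<union> (place (p1, p2) ` A \<union> place (p2, p3) ` A \<union> D))) h"
    unfolding region_loss_def by simp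
  also have "\<dots> \<le> shift_loss (place (0, p1) ` A) h + (shift_loss (place (p3, 1) ` A) h
      + shift_loss (place (p1, p2) ` A \<union> place (p2, p3) ` A \<union> D) h)"
    by (intro order_trans[OF shift_loss_Un] add_mono shift_loss_Un fmeasurable.Un fm order_refl)
  finally show ?thesis by (simp add: shift_loss_copies)
qed

lemma defect_ge: "- (triangle_const * cmod h) \<le> defect h"
proof -
  have "shift_loss (place (p1, p2) ` A \<union> place (p2, p3) ` A \<union> D) h \<le>
      shift_loss (place (p1, p2) ` A) h + shift_loss (place (p2, p3) ` A) h + shift_loss D h"
    by (intro order_trans[OF shift_loss_Un] add_mono shift_loss_Un fmeasurable.Un fmeasurable_copies order_refl)
  then show ?thesis
    using region_loss_le_central[of h] shift_loss_D[of h] by (simp add: defect_def shift_loss_copies)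
qed

text \<open>The turns of the central copies only permute the orbit, so after summation both
  contribute the same orbit sum at h / r.\<close>

lemma defect_sum:
  fixes h :: complex
  shows "defect h + defect (\<zeta> * h) + defect (\<zeta> * (\<zeta> * h)) =
    2 * a\<^sup>2 * orbit_loss (h / a) + 2 * r\<^sup>2 * orbit_loss (h / r) - orbit_loss h"
proof -
  have "2 * a\<^sup>2 * orbit_loss (h / a) + r\<^sup>2 * orbit_loss (\<zeta> * (h / r)) + r\<^sup>2 * orbit_loss ((1 - \<zeta>) * (h / r)) - orbit_loss h =
      defect h + defect (\<zeta> * h) + defect (\<zeta> * (\<zeta> * h))"
    unfolding defect_def orbit_loss_def times_divide_eq_right[symmetric] mult.left_commute[of "1 - \<zeta>" \<zeta>]
    by (simp only: algebra_simps)
  then show ?thesis unfolding orbit_loss_zeta orbit_loss_one_minus_zeta by linarith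
qed

lemma orbit_loss_nonneg: "0 \<le> orbit_loss h" by (simp add: orbit_loss_def)

lemma orbit_loss_le: "orbit_loss h \<le> 3 * measure lborel A"
  using shift_loss_le_measure[OF fmeasurable_A, of h] shift_loss_le_measure[OF fmeasurable_A, of "\<zeta> * h"]
    shift_loss_le_measure[OF fmeasurable_A, of "\<zeta> * (\<zeta> * h)"]
  by (simp add: orbit_loss_def region_loss_def)

lemma orbit_loss_sub:
  fixes h :: complex
  shows "orbit_loss h \<le> 2 * a\<^sup>2 * orbit_loss (h / a) + 2 * r\<^sup>2 * orbit_loss (h / r) + 3 * triangle_const * cmod h"
  using defect_sum[of h] defect_ge[of h] defect_ge[of "\<zeta> * h"] defect_ge[of "\<zeta> * (\<zeta> * h)"]
  by (simp add: norm_mult)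

lemma orbit_loss_diff: "\<bar>orbit_loss h - orbit_loss k\<bar> \<le> orbit_loss (h - k)"
  using abs_shift_loss_diff_le[OF fmeasurable_A, of h k]
    abs_shift_loss_diff_le[OF fmeasurable_A, of "\<zeta> * h" "\<zeta> * k"]
    abs_shift_loss_diff_le[OF fmeasurable_A, of "\<zeta> * (\<zeta> * h)" "\<zeta> * (\<zeta> * k)"]
  unfolding orbit_loss_def region_loss_def right_diff_distrib by linarith

lemma pair_defect_nonneg: "0 \<le> pair_defect h"
  using shift_loss_Un[OF fmeasurable.Un[OF fmeasurable_A fmeasurable_place[OF one_neq_zeta fmeasurable_A]] fmeasurable_unit_triangle, of h]
    shift_loss_Un[OF fmeasurable_A fmeasurable_place[OF one_neq_zeta fmeasurable_A], of h]
  by (simp add: pair_defect_def region_loss_def)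

text \<open>The two copies of the region on the sides of the central bump, together with the bump,
  are similar to two sides of the snowflake together with the initial triangle.\<close>

lemma pair_defect_le:
  "r\<^sup>2 * pair_defect h \<le> defect ((p2 - p1) * h) + triangle_const * cmod ((p2 - p1) * h)"
proof -
  define k where "k = (p2 - p1) * h"
  have h: "h = k / (p2 - p1)" using distinct by (simp add: k_def)
  have "place (p1, p2) \<zeta> = p3"
    by (simp add: place_def p1_def p2_def p3_def mult.assoc one_minus_zeta_times_zeta)
  then have eq: "place (p1, p2) ` place (1, \<zeta>) ` A = place (p2, p3) ` A"
    using place_place[of "(p1, p2)" 1 \<zeta>] by (simp add: image_image)
  note fm = fmeasurable_A fmeasurable_place[OF one_neq_zeta fmeasurable_A] fmeasurable_unit_triangle
    fmeasurable.Un[OF fmeasurable.Un[OF fmeasurable_A fmeasurable_place[OF one_neq_zeta fmeasurable_A]] fmeasurable_unit_triangle]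
  have sl: "r\<^sup>2 * shift_loss X h = shift_loss (place (p1, p2) ` X) k" if "X \<in> fmeasurable lborel" for X
    using shift_loss_place[OF distinct(2) that, of k] slopes by (simp add: h)
  have "r\<^sup>2 * pair_defect h = r\<^sup>2 * shift_loss A h + r\<^sup>2 * shift_loss (place (1, \<zeta>) ` A) h
      + r\<^sup>2 * shift_loss unit_triangle h - r\<^sup>2 * shift_loss (A \<union> place (1, \<zeta>) ` A \<union> unit_triangle) h"
    by (simp add: pair_defect_def region_loss_def algebra_simps)
  also have "\<dots> = shift_loss (place (p1, p2) ` A) k + shift_loss (place (p2, p3) ` A) k + shift_loss D k
      - shift_loss (place (p1, p2) ` A \<union> place (p2, p3) ` A \<union> D) k"
    unfolding sl[OF fm(1)] sl[OF fm(2)] sl[OF fm(3)] sl[OF fm(4)] image_Un eq ..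
  also have "\<dots> \<le> defect k + triangle_const * cmod k"
    using region_loss_le_central[of k] shift_loss_D[of k] by (simp add: shift_loss_copies defect_def)
  finally show ?thesis by (simp add: k_def)
qed

section \<open>The three sides and the initial triangle put together\<close>

definition "filled = A \<union> place (1, \<zeta>) ` A \<union> place (\<zeta>, 0) ` A \<union> unit_triangle"

lemmas fmeasurable_sides = fmeasurable_A fmeasurable_place[OF one_neq_zeta fmeasurable_A]
  fmeasurable_place[OF cis_neq_zero[of "pi / 3"] fmeasurable_A] fmeasurable_unit_triangle

lemma fmeasurable_filled: "filled \<in> fmeasurable lborel"
  unfolding filled_def by (intro fmeasurable.Un fmeasurable_sides)

text \<open>The sides have directions 1, \<open>\<zeta> - 1\<close> and \<open>- \<zeta>\<close>; as
  the loss is even, dividing h by them gives the three arguments of the orbit sum, all with ratio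
  1.\<close>

lemma sides_sum:
  "region_loss h + shift_loss (place (1, \<zeta>) ` A) h + shift_loss (place (\<zeta>, 0) ` A) h = orbit_loss h"
proof -
  have "h / (\<zeta> - 1) = - (\<zeta> * h)"
    using divide_one_minus_zeta[of h] by (metis minus_diff_eq minus_divide_right)
  moreover have "h / (0 - \<zeta>) = \<zeta> * (\<zeta> * h)"
  proof -
    have "h / (0 - \<zeta>) = - ((1 - \<zeta>) * h)"
      by (simp only: diff_0 minus_divide_right[symmetric] divide_zeta)
    also have "\<dots> = \<zeta> * \<zeta> * h" by (simp add: zeta_square algebra_simps)
    finally show ?thesis by (simp add: mult.assoc)
  qed
  ultimately show ?thesis
    using shift_loss_place[OF one_neq_zeta fmeasurable_A, of h] shift_loss_place[OF cis_neq_zero fmeasurable_A, of "pi / 3" h]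
    by (simp add: orbit_loss_def region_loss_def[symmetric] norm_minus_commute[of \<zeta> 1] cmod_one_minus_zeta)
qed

lemma shift_loss_filled_le: "shift_loss filled h \<le> orbit_loss h + triangle_const * cmod h"
proof -
  have "shift_loss filled h \<le> region_loss h + shift_loss (place (1, \<zeta>) ` A) h + shift_loss (place (\<zeta>, 0) ` A) h + shift_loss unit_triangle h"
    unfolding filled_def region_loss_def
    by (intro order_trans[OF shift_loss_Un] add_mono fmeasurable.Un fmeasurable_sides order_refl)
  then show ?thesis using triangle_const(2)[of h] sides_sum[of h] by simp
qed

text \<open>The rotation \<open>place (1, \<zeta>)\<close> by 2 pi / 3 about the centre of the
  triangle permutes the sides cyclically and preserves the triangle. All three corners therefore
  have the same pair defect at rotated arguments; dividing by \<open>\<zeta> - 1\<close> undoes one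
  rotation.\<close>

lemma shift_loss_filled_ge:
  "orbit_loss h \<le> shift_loss filled h + 3 * (pair_defect h + pair_defect (h / (\<zeta> - 1)) + pair_defect (h / (\<zeta> - 1) / (\<zeta> - 1)))"
proof -
  let ?\<rho> = "place (1, \<zeta>)"
  have \<zeta>0: "place (1, \<zeta>) \<zeta> = 0" by (simp add: place_def algebra_simps zeta_square)
  have \<rho>T: "?\<rho> ` unit_triangle = unit_triangle"
    by (simp add: unit_triangle_def place_convex_hull \<zeta>0 insert_commute)
  have \<rho>2: "?\<rho> ` ?\<rho> ` A = place (\<zeta>, 0) ` A"
    using place_place[of "(1, \<zeta>)" 1 \<zeta>] by (simp add: image_image \<zeta>0)
  have "place (place (1, \<zeta>) \<zeta>, place (1, \<zeta>) 0) z = z" for z by (simp only: \<zeta>0 place_0 fst_conv place_unit)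
  then have \<rho>3: "?\<rho> ` place (\<zeta>, 0) ` A = A"
    using place_place[of "(1, \<zeta>)" \<zeta> 0] by (simp add: image_image)
  have sl: "shift_loss (?\<rho> ` X) h = shift_loss X (h / (\<zeta> - 1))" if "X \<in> fmeasurable lborel" for X h
    using shift_loss_place[OF one_neq_zeta that, of h] by (simp add: norm_minus_commute[of \<zeta> 1] cmod_one_minus_zeta)
  let ?pd = "\<lambda>X Y h. shift_loss X h + shift_loss Y h + shift_loss unit_triangle h - shift_loss (X \<union> Y \<union> unit_triangle) h"
  have pd: "?pd (?\<rho> ` X) (?\<rho> ` Y) h = ?pd X Y (h / (\<zeta> - 1))"
    if "X \<in> fmeasurable lborel" "Y \<in> fmeasurable lborel" for X Y h
  proof -
    have "shift_loss (?\<rho> ` X \<union> ?\<rho> ` Y \<union> unit_triangle) h = shift_loss (?\<rho> ` (X \<union> Y \<union> unit_triangle)) h"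
      by (simp add: image_Un \<rho>T)
    then show ?thesis
      using sl[of unit_triangle h] that by (simp add: sl fmeasurable.Un fmeasurable_unit_triangle \<rho>T)
  qed
  note fm = fmeasurable_sides
  have 12: "?pd A (?\<rho> ` A) h = pair_defect h" for h by (simp add: pair_defect_def region_loss_def)
  have 23: "?pd (?\<rho> ` A) (place (\<zeta>, 0) ` A) h = pair_defect (h / (\<zeta> - 1))" for h
    using pd[OF fm(1,2), of h] unfolding \<rho>2 12 .
  have 31: "?pd (place (\<zeta>, 0) ` A) A h = pair_defect (h / (\<zeta> - 1) / (\<zeta> - 1))"
    using pd[OF fm(2,3), of h] unfolding \<rho>2 \<rho>3 23 .
  show ?thesis
    using shift_loss_three_sets[OF fm, of h]
    unfolding filled_def[symmetric] 12 23 31 using sides_sum[of h] by (simp add: region_loss_def)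
qed

end

section \<open>Asymptotics of the loss function\<close>

lemma nonneg_le_contraction_eq_0:
  fixes c :: real
  assumes "0 \<le> m" "m \<le> c * m" "c < 1"
  shows "m = 0"
proof -
  have "(1 - c) * m \<le> 0" using assms by (simp add: algebra_simps)
  then show ?thesis using assms by (simp add: mult_le_0_iff)
qed

lemma closure_place_subset: "compact (closure X) \<Longrightarrow> closure (place s ` X) \<subseteq> place s ` closure X"
  by (intro closure_minimal image_mono closure_subset compact_imp_closed
      compact_continuous_image continuous_on_place)

lemma frontier_null:
  fixes X :: "'a::euclidean_space set"
  shows "convex X \<Longrightarrow> frontier X \<in> null_sets lborel"
  using negligible_convex_frontier[of X]
  by (simp add: negligible_iff_null_sets null_sets_completion_iff)

lemma convex_place: "convex X \<Longrightarrow> convex (place s ` X)"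
  using place_convex_hull[of s X] by (simp add: convex_hull_eq[symmetric])

locale koch_dimension = koch \<eta> + C: contraction_pair "koch.a \<eta>" "koch.r \<eta>" \<alpha> for \<eta> \<alpha>
begin

abbreviation "\<beta> \<equiv> C.\<beta>"
lemmas \<beta> = C.\<beta>

lemma powr_scale:
  assumes "c > 0" "t > 0"
  shows "c\<^sup>2 * x / t powr \<beta> = c powr \<alpha> * (x / (t / c) powr \<beta>)"
proof -
  have "c powr \<alpha> * c powr \<beta> = c\<^sup>2"
    using assms by (simp add: powr_add[symmetric] C.\<beta>_def)
  then have "c\<^sup>2 * x / t powr \<beta> = c powr \<alpha> * c powr \<beta> * x / t powr \<beta>" by simp
  then show ?thesis using assms by (simp add: powr_divide)
qed

lemma linear_negligible: "((\<lambda>t. C * t / t powr \<beta>) \<longlongrightarrow> 0) (at_right 0)"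
proof -
  have "((\<lambda>t. C * t powr (1 - \<beta>)) \<longlongrightarrow> C * 0) (at_right 0)"
    using \<beta> by (intro tendsto_intros tendsto_zero_powrI[OF _ tendsto_const])
      (auto intro: tendsto_ident_at simp: eventually_at_filter)
  moreover have "eventually (\<lambda>t. C * t powr (1 - \<beta>) = C * t / t powr \<beta>) (at_right 0)"
    using eventually_at_right_less[of "0::real"] by eventually_elim (simp add: powr_diff)
  ultimately show ?thesis by (auto intro: Lim_transform_eventually)
qed

text \<open>On a fixed ray the orbit sum is a function of the scalar t, and its recursion involves
  only t / a and t / r on the same ray.\<close>

lemma orbit_loss_tendsto:
  assumes "ln a / ln r \<notin> \<rat>"
  shows "\<exists>l. ((\<lambda>t. orbit_loss (of_real t * h) / t powr \<beta>) \<longlongrightarrow> l) (at_right 0)"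
proof (rule C.tendsto_of_approximate_subsimilarity[OF assms])
  show "0 \<le> 3 * triangle_const * cmod h" using triangle_const by simp
  show "orbit_loss (of_real t * h) \<le> 3 * measure lborel A" for t by (rule orbit_loss_le)
  show "0 \<le> orbit_loss (of_real t * h)" for t by (rule orbit_loss_nonneg)
  show "\<bar>orbit_loss (of_real t * h) - orbit_loss (of_real s * h)\<bar> \<le> orbit_loss (of_real (t - s) * h)" for s t
    using orbit_loss_diff[of "of_real t * h" "of_real s * h"] by (simp add: left_diff_distrib)
  show "orbit_loss (of_real t * h) \<le> 2 * a\<^sup>2 * orbit_loss (of_real (t / a) * h) + 2 * r\<^sup>2 * orbit_loss (of_real (t / r) * h)
      + 3 * triangle_const * cmod h * t" if "t > 0" for t
    using orbit_loss_sub[of "of_real t * h"] that by (simp add: norm_mult mult.assoc mult.commute[of t])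
qed

text \<open>The constant from \<open>power_bound\<close> depends only on the area of
  \<open>A\<close> and on \<open>triangle_const\<close>, hence not on the direction; the domination
  of the integral relies on this uniformity.\<close>

lemma orbit_loss_bound:
  obtains M where "M \<ge> 0" "\<And>h. orbit_loss h \<le> M * cmod h powr \<beta>"
proof -
  define K where "K = 3 * measure lborel A"
  define M where "M = K + C.linear_slack (3 * triangle_const) * exp (max (- ln a) (- ln r))"
  have M: "M \<ge> 0" using C.linear_slack_nonneg[of "3 * triangle_const"] triangle_const by (simp add: M_def K_def)
  have "orbit_loss h \<le> M * cmod h powr \<beta>" for h
  proof (cases "h = 0")
    case True
    then show ?thesis using \<beta> by (simp add: orbit_loss_def region_loss_def)
  next
    case False
    define u where "u = h / cmod h"
    have u: "cmod u = 1" "h = of_real (cmod h) * u" using False by (simp_all add: u_def norm_divide)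
    have "orbit_loss (of_real (cmod h) * u) \<le> M * cmod h powr \<beta>"
      unfolding M_def
    proof (rule C.power_bound)
      show "0 \<le> 3 * triangle_const" using triangle_const by simp
      show "orbit_loss (of_real t * u) \<le> K" for t unfolding K_def by (rule orbit_loss_le)
      show "0 \<le> orbit_loss (of_real t * u)" for t by (rule orbit_loss_nonneg)
      show "orbit_loss (of_real t * u) \<le> 2 * a\<^sup>2 * orbit_loss (of_real (t / a) * u) + 2 * r\<^sup>2 * orbit_loss (of_real (t / r) * u)
          + 3 * triangle_const * t" if "t > 0" for t
        using orbit_loss_sub[of "of_real t * u"] that u by (simp add: norm_mult mult.assoc)
    qed (use False in auto)
    then show ?thesis using u(2) by simp
  qed
  then show thesis using M that by blast
qed

text \<open>The defects of the three rotated arguments sum to a quantity that vanishes in the limit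
  by \<open>2 * a powr \<alpha> + 2 * r powr \<alpha> = 1\<close>, and each of them is bounded below by a linear term.\<close>

lemma defect_tendsto:
  assumes "ln a / ln r \<notin> \<rat>"
  shows "((\<lambda>t. defect (of_real t * h) / t powr \<beta>) \<longlongrightarrow> 0) (at_right 0)"
proof -
  obtain l where l: "((\<lambda>t. orbit_loss (of_real t * h) / t powr \<beta>) \<longlongrightarrow> l) (at_right 0)"
    using orbit_loss_tendsto[OF assms] by blast
  have scaled: "((\<lambda>t. c\<^sup>2 * orbit_loss (of_real t * h / c) / t powr \<beta>) \<longlongrightarrow> c powr \<alpha> * l) (at_right 0)" if c: "c > 0" for c :: real
  proof -
    have "filterlim (\<lambda>t. t / c) (at_right 0) (at_right 0)"
      using c by (auto intro!: tendsto_eq_intros simp: filterlim_at eventually_at_filter)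
    from filterlim_compose[OF l this]
    have "((\<lambda>t. c powr \<alpha> * (orbit_loss (of_real (t / c) * h) / (t / c) powr \<beta>)) \<longlongrightarrow> c powr \<alpha> * l) (at_right 0)"
      by (intro tendsto_intros)
    moreover have "eventually (\<lambda>t. c powr \<alpha> * (orbit_loss (of_real (t / c) * h) / (t / c) powr \<beta>)
        = c\<^sup>2 * orbit_loss (of_real t * h / c) / t powr \<beta>) (at_right 0)"
      using eventually_at_right_less[of "0::real"]
      by eventually_elim (use c in \<open>simp add: powr_scale\<close>)
    ultimately show ?thesis by (rule Lim_transform_eventually)
  qed
  define E where "E h = 2 * a\<^sup>2 * orbit_loss (h / a) + 2 * r\<^sup>2 * orbit_loss (h / r) - orbit_loss h" for h :: complex
  have "((\<lambda>t. 2 * (a\<^sup>2 * orbit_loss (of_real t * h / a) / t powr \<beta>) + 2 * (r\<^sup>2 * orbit_loss (of_real t * h / r) / t powr \<beta>)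
      - orbit_loss (of_real t * h) / t powr \<beta>) \<longlongrightarrow> 2 * (a powr \<alpha> * l) + 2 * (r powr \<alpha> * l) - l) (at_right 0)"
    by (intro tendsto_intros scaled l a r)
  also have "2 * (a powr \<alpha> * l) + 2 * (r powr \<alpha> * l) - l = (2 * a powr \<alpha> + 2 * r powr \<alpha> - 1) * l"
    by (simp add: algebra_simps)
  also have "\<dots> = 0" using C.dim by simp
  finally have "((\<lambda>t. E (of_real t * h) / t powr \<beta>) \<longlongrightarrow> 0) (at_right 0)"
    by (simp add: E_def add_divide_distrib diff_divide_distrib mult.assoc)
  \<comment> \<open>One defect is the sum \<open>E\<close> minus the other two, each bounded below
    by a linear term; hence the factor 2.\<close>
  then have upper: "((\<lambda>t. E (of_real t * h) / t powr \<beta> + (2 * triangle_const * cmod h) * t / t powr \<beta>) \<longlongrightarrow> 0 + 0) (at_right 0)"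
    by (intro tendsto_intros linear_negligible)
  show ?thesis
  proof (rule tendsto_sandwich)
    show "((\<lambda>t. (- triangle_const * cmod h) * t / t powr \<beta>) \<longlongrightarrow> 0) (at_right 0)"
      by (rule linear_negligible)
    show "((\<lambda>t. E (of_real t * h) / t powr \<beta> + (2 * triangle_const * cmod h) * t / t powr \<beta>) \<longlongrightarrow> 0) (at_right 0)"
      using upper by simp
    show "\<forall>\<^sub>F t in at_right 0. (- triangle_const * cmod h) * t / t powr \<beta> \<le> defect (of_real t * h) / t powr \<beta>"
      using eventually_at_right_less[of "0::real"]
    proof eventually_elim
      case (elim t)
      then show ?case using defect_ge[of "of_real t * h"]
        by (intro divide_right_mono) (auto simp: norm_mult algebra_simps)
    qed
    show "\<forall>\<^sub>F t in at_right 0. defect (of_real t * h) / t powr \<beta> \<le>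
        E (of_real t * h) / t powr \<beta> + (2 * triangle_const * cmod h) * t / t powr \<beta>"
      using eventually_at_right_less[of "0::real"]
    proof eventually_elim
      case (elim t)
      have "defect (of_real t * h) \<le> E (of_real t * h) + (2 * triangle_const * cmod h) * t"
        using defect_sum[of "of_real t * h"] defect_ge[of "\<zeta> * (of_real t * h)"]
          defect_ge[of "\<zeta> * (\<zeta> * (of_real t * h))"] elim
        by (simp add: E_def norm_mult algebra_simps)
      then show ?case unfolding add_divide_distrib[symmetric]
        by (intro divide_right_mono) auto
    qed
  qed
qed

lemma pair_defect_tendsto:
  assumes "ln a / ln r \<notin> \<rat>"
  shows "((\<lambda>t. pair_defect (of_real t * h) / t powr \<beta>) \<longlongrightarrow> 0) (at_right 0)"
proof (rule tendsto_sandwich)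
  let ?k = "(p2 - p1) * h"
  show "((\<lambda>_. 0) \<longlongrightarrow> (0::real)) (at_right (0::real))" by simp
  let ?u = "\<lambda>t. (1 / r\<^sup>2) * (defect (of_real t * ?k) / t powr \<beta> + (triangle_const * cmod ?k) * t / t powr \<beta>)"
  have "(?u \<longlongrightarrow> (1 / r\<^sup>2) * (0 + 0)) (at_right 0)"
    by (intro tendsto_intros linear_negligible defect_tendsto assms)
  then show "(?u \<longlongrightarrow> 0) (at_right 0)" by simp
  show "\<forall>\<^sub>F t in at_right 0. 0 \<le> pair_defect (of_real t * h) / t powr \<beta>"
    by (simp add: pair_defect_nonneg)
  show "\<forall>\<^sub>F t in at_right 0. pair_defect (of_real t * h) / t powr \<beta> \<le> ?u t"
    using eventually_at_right_less[of "0::real"]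
  proof eventually_elim
    case (elim t)
    have "pair_defect (of_real t * h) = (1 / r\<^sup>2) * (r\<^sup>2 * pair_defect (of_real t * h))" using r by simp
    also have "\<dots> \<le> (1 / r\<^sup>2) * (defect (of_real t * ?k) + (triangle_const * cmod ?k) * t)"
      using pair_defect_le[of "of_real t * h"] elim
      by (intro mult_left_mono) (auto simp: norm_mult mult_ac)
    finally have "pair_defect (of_real t * h) / t powr \<beta> \<le>
        (1 / r\<^sup>2) * (defect (of_real t * ?k) + (triangle_const * cmod ?k) * t) / t powr \<beta>"
      by (intro divide_right_mono) auto
    then show ?case by (simp only: add_divide_distrib times_divide_eq_right[symmetric])
  qed
qed

lemma shift_loss_filled_tendsto:
  assumes irr: "ln a / ln r \<notin> \<rat>"
  shows "\<exists>l. ((\<lambda>t. shift_loss filled (of_real t * h) / t powr \<beta>) \<longlongrightarrow> l) (at_right 0)"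
proof -
  obtain l where l: "((\<lambda>t. orbit_loss (of_real t * h) / t powr \<beta>) \<longlongrightarrow> l) (at_right 0)"
    using orbit_loss_tendsto[OF irr] by blast
  let ?k = "h / (\<zeta> - 1)" and ?k' = "h / (\<zeta> - 1) / (\<zeta> - 1)"
  let ?p = "\<lambda>h t. pair_defect (of_real t * h) / t powr \<beta>"
  have "((\<lambda>t. shift_loss filled (of_real t * h) / t powr \<beta>) \<longlongrightarrow> l) (at_right 0)"
  proof (rule tendsto_sandwich)
    have "((\<lambda>t. orbit_loss (of_real t * h) / t powr \<beta> - 3 * (?p h t + ?p ?k t + ?p ?k' t)) \<longlongrightarrow> l - 3 * (0 + 0 + 0)) (at_right 0)"
      by (intro tendsto_intros l pair_defect_tendsto irr)
    then show "((\<lambda>t. orbit_loss (of_real t * h) / t powr \<beta> - 3 * (?p h t + ?p ?k t + ?p ?k' t)) \<longlongrightarrow> l) (at_right 0)" by simp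
    have "((\<lambda>t. orbit_loss (of_real t * h) / t powr \<beta> + (triangle_const * cmod h) * t / t powr \<beta>) \<longlongrightarrow> l + 0) (at_right 0)"
      by (intro tendsto_intros l linear_negligible)
    then show "((\<lambda>t. orbit_loss (of_real t * h) / t powr \<beta> + (triangle_const * cmod h) * t / t powr \<beta>) \<longlongrightarrow> l) (at_right 0)" by simp
    show "\<forall>\<^sub>F t in at_right 0. orbit_loss (of_real t * h) / t powr \<beta> - 3 * (?p h t + ?p ?k t + ?p ?k' t)
        \<le> shift_loss filled (of_real t * h) / t powr \<beta>"
    proof (intro always_eventually allI)
      fix t :: real
      have "orbit_loss (of_real t * h) - 3 * (pair_defect (of_real t * h) + pair_defect (of_real t * ?k) + pair_defect (of_real t * ?k'))
          \<le> shift_loss filled (of_real t * h)"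
        using shift_loss_filled_ge[of "of_real t * h"] by simp
      then have "(orbit_loss (of_real t * h) - 3 * (pair_defect (of_real t * h) + pair_defect (of_real t * ?k) + pair_defect (of_real t * ?k'))) / t powr \<beta>
          \<le> shift_loss filled (of_real t * h) / t powr \<beta>"
        by (intro divide_right_mono) auto
      then show "orbit_loss (of_real t * h) / t powr \<beta> - 3 * (?p h t + ?p ?k t + ?p ?k' t)
        \<le> shift_loss filled (of_real t * h) / t powr \<beta>"
        by (simp only: diff_divide_distrib add_divide_distrib times_divide_eq_right[symmetric])
    qed
    show "\<forall>\<^sub>F t in at_right 0. shift_loss filled (of_real t * h) / t powr \<beta>
        \<le> orbit_loss (of_real t * h) / t powr \<beta> + (triangle_const * cmod h) * t / t powr \<beta>"
      using eventually_at_right_less[of "0::real"]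
    proof eventually_elim
      case (elim t)
      then show ?case using shift_loss_filled_le[of "of_real t * h"] unfolding add_divide_distrib[symmetric]
        by (intro divide_right_mono) (auto simp: norm_mult mult_ac)
    qed
  qed
  then show ?thesis ..
qed

text \<open>For |h| \<le> 1 the linear term is dominated because \<beta> < 1; for |h| > 1 the total
  area serves as the bound.\<close>

lemma shift_loss_filled_bound:
  obtains M where "M \<ge> 0" "\<And>h. shift_loss filled h \<le> M * cmod h powr \<beta>"
proof -
  obtain M where M: "M \<ge> 0" "\<And>h. orbit_loss h \<le> M * cmod h powr \<beta>" using orbit_loss_bound by blast
  define N where "N = M + triangle_const + measure lborel filled"
  have "shift_loss filled h \<le> N * cmod h powr \<beta>" for h
  proof (cases "cmod h \<le> 1")
    case True
    have "cmod h \<le> cmod h powr \<beta>"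
      using powr_mono'[of \<beta> 1 "cmod h"] True \<beta> by simp
    then have "triangle_const * cmod h \<le> triangle_const * cmod h powr \<beta>"
      using triangle_const by (intro mult_left_mono)
    moreover have "0 \<le> measure lborel filled * cmod h powr \<beta>" by simp
    ultimately show ?thesis using shift_loss_filled_le[of h] M(2)[of h]
      unfolding N_def distrib_right by linarith
  next
    case False
    then have "1 \<le> cmod h powr \<beta>" using \<beta> by (simp add: ge_one_powr_ge_zero)
    then have "measure lborel filled * 1 \<le> N * cmod h powr \<beta>"
      using M triangle_const by (intro mult_mono) (auto simp: N_def)
    then show ?thesis using shift_loss_le_measure[OF fmeasurable_filled, of h] by simp
  qed
  moreover have "N \<ge> 0" using M triangle_const by (simp add: N_def)
  ultimately show thesis using that by blast
qed

section \<open>The snowflake and the union of triangles agree up to a null set\<close>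

lemma area_ratio: "2 * a\<^sup>2 + 2 * r\<^sup>2 < 1"
proof -
  have "c\<^sup>2 < c powr \<alpha>" if "0 < c" "c < 1" for c :: real
  proof -
    have "2 * ln c < \<alpha> * ln c" using that C.\<alpha> by (intro mult_strict_right_mono_neg) auto
    then have "exp (2 * ln c) < exp (\<alpha> * ln c)" by simp
    then show ?thesis using that by (simp add: powr_def exp_double)
  qed
  from this[of a] this[of r] show ?thesis using a r C.dim by simp
qed

text \<open>The points added by the closure are covered by four copies of themselves of total
  relative area \<open>2 * a\<^sup>2 + 2 * r\<^sup>2 < 1\<close>.\<close>

lemma closure_A_null: "closure A - A \<in> null_sets lborel"
proof -
  define N where "N = closure A - A"
  have cA: "compact (closure A)" using bounded_A by (simp add: compact_closure)
  have N: "N \<in> fmeasurable lborel"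
    unfolding N_def using cA by (intro fmeasurable_Diff fmeasurable_compact) auto
  have clD: "closure D = D"
    by (intro closure_closed compact_imp_closed compact_continuous_image continuous_on_place compact_unit_triangle)
  \<comment> \<open>The bump is closed and adds nothing new. A new point in a copy of the closure of
    \<open>A\<close> is outside the corresponding copy of \<open>A\<close>, because that copy is
    contained in \<open>A\<close>.\<close>
  have sub: "N \<subseteq> place (0, p1) ` N \<union> (place (p1, p2) ` N \<union> (place (p2, p3) ` N \<union> place (p3, 1) ` N))"
  proof
    fix z assume z: "z \<in> N"
    have "closure A \<subseteq> D \<union> (place (0, p1) ` closure A \<union> place (p1, p2) ` closure A \<union> place (p2, p3) ` closure A \<union> place (p3, 1) ` closure A)"
      by (subst A_rec, simp only: closure_Un clD)
         (intro Un_mono closure_place_subset cA order_refl)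
    then show "z \<in> place (0, p1) ` N \<union> (place (p1, p2) ` N \<union> (place (p2, p3) ` N \<union> place (p3, 1) ` N))"
      using z unfolding N_def by (subst (asm) (3) A_rec) blast
  qed
  have fm: "place (x, y) ` N \<in> fmeasurable lborel"
    and ms: "measure lborel (place (x, y) ` N) = (cmod (y - x))\<^sup>2 * measure lborel N" if "x \<noteq> y" for x y
    using fmeasurable_place[OF that N] measure_place[OF that N] .
  note fms = fm[OF distinct(1)] fm[OF distinct(2)] fm[OF distinct(3)] fm[OF distinct(4)]
  have "measure lborel N \<le> measure lborel (place (0, p1) ` N \<union> (place (p1, p2) ` N \<union> (place (p2, p3) ` N \<union> place (p3, 1) ` N)))"
    using sub N fms by (intro measure_mono_fmeasurable fmeasurable.Un) (auto dest: fmeasurableD)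
  also have "\<dots> \<le> measure lborel (place (0, p1) ` N) + (measure lborel (place (p1, p2) ` N)
      + (measure lborel (place (p2, p3) ` N) + measure lborel (place (p3, 1) ` N)))"
    by (intro order_trans[OF measure_Un_le] add_left_mono order_refl sets.Un fmeasurableD fms)
  also have "\<dots> = (2 * a\<^sup>2 + 2 * r\<^sup>2) * measure lborel N"
    using ms[OF distinct(1)] ms[OF distinct(2)] ms[OF distinct(3)] ms[OF distinct(4)] slopes(5-8)
    by (simp add: algebra_simps)
  finally have "measure lborel N = 0"
    using nonneg_le_contraction_eq_0[OF _ _ area_ratio] by simp
  then have "N \<in> null_sets lborel"
    using N by (auto simp: null_sets_def fmeasurable_def emeasure_eq_ennreal_measure)
  then show ?thesis by (simp add: N_def)
qed

lemma null_place: "x \<noteq> y \<Longrightarrow> X \<in> null_sets lborel \<Longrightarrow> place (x, y) ` X \<in> null_sets lborel"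
proof -
  assume xy: "x \<noteq> y" and X: "X \<in> null_sets lborel"
  then have "X \<in> fmeasurable lborel" "measure lborel X = 0"
    by (auto simp: fmeasurable_def null_sets_def measure_def)
  then have "place (x, y) ` X \<in> fmeasurable lborel" "measure lborel (place (x, y) ` X) = 0"
    using fmeasurable_place[OF xy] measure_place[OF xy] by simp_all
  then show ?thesis by (auto simp: null_sets_def fmeasurable_def emeasure_eq_ennreal_measure)
qed

text \<open>Points of the snowflake outside \<open>filled\<close> were added by the closure.
  Conversely the interior of every triangle is an open subset of the closure, so only points on the
  frontiers of countably many triangles can be missed.\<close>

lemma snowflake_AE: "AE z in lborel. z \<in> koch_snowflake \<eta> \<longleftrightarrow> z \<in> filled"
proof -
  have cA: "compact (closure A)" using bounded_A by (simp add: compact_closure)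
  have clT: "closure unit_triangle = unit_triangle" by (simp add: compact_imp_closed compact_unit_triangle)
  let ?N = "closure A - A"
  have S: "koch_snowflake \<eta> = interior (closure filled)" by (simp add: snowflake_eq filled_def)
  have null: "?N \<union> place (1, \<zeta>) ` ?N \<union> place (\<zeta>, 0) ` ?N \<in> null_sets lborel"
    by (intro null_sets.Un null_place closure_A_null one_neq_zeta cis_neq_zero)
  have "closure filled - filled \<subseteq> ?N \<union> place (1, \<zeta>) ` ?N \<union> place (\<zeta>, 0) ` ?N"
  proof -
    have "closure filled \<subseteq> closure A \<union> place (1, \<zeta>) ` closure A \<union> place (\<zeta>, 0) ` closure A \<union> unit_triangle"
      unfolding filled_def closure_Un clT by (intro Un_mono closure_place_subset cA order_refl)
    then show ?thesis unfolding filled_def by blast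
  qed
  moreover have "koch_snowflake \<eta> \<subseteq> closure filled" unfolding S by (rule interior_subset)
  ultimately have 1: "AE z in lborel. z \<in> koch_snowflake \<eta> \<longrightarrow> z \<in> filled"
    by (intro AE_I'[OF null]) blast
  have 2: "AE z in lborel. z \<in> koch_region \<eta> s \<longrightarrow> z \<in> koch_snowflake \<eta>" if "koch_region \<eta> s \<subseteq> filled" for s
  proof (rule AE_I')
    let ?F = "\<Union>n. \<Union>t\<in>koch_descendants \<eta> n s. frontier (koch_tri \<eta> t)"
    show "?F \<in> null_sets lborel"
      by (intro null_sets_UN null_sets_UN' frontier_null countable_finite finite_koch_descendants)
        (simp_all add: koch_tri_place convex_place convex_unit_triangle)
    show "{z \<in> space lborel. \<not> (z \<in> koch_region \<eta> s \<longrightarrow> z \<in> koch_snowflake \<eta>)} \<subseteq> ?F"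
    proof (rule subsetI)
      fix z assume "z \<in> {z \<in> space lborel. \<not> (z \<in> koch_region \<eta> s \<longrightarrow> z \<in> koch_snowflake \<eta>)}"
      then have z: "z \<in> koch_region \<eta> s" "z \<notin> koch_snowflake \<eta>" by auto
      then obtain n t where t: "t \<in> koch_descendants \<eta> n s" "z \<in> koch_tri \<eta> t"
        by (auto simp: koch_region_def)
      then have "koch_tri \<eta> t \<subseteq> closure filled"
        using that closure_subset[of filled] by (auto simp: koch_region_def)
      then have "interior (koch_tri \<eta> t) \<subseteq> koch_snowflake \<eta>" unfolding S by (rule interior_mono)
      then have "z \<in> frontier (koch_tri \<eta> t)"
        using z t closure_subset[of "koch_tri \<eta> t"] by (auto simp: frontier_def)
      then show "z \<in> ?F" using t by blast
    qed
  qed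
  have filled: "filled = koch_region \<eta> (0, 1) \<union> koch_region \<eta> (1, \<zeta>) \<union> koch_region \<eta> (\<zeta>, 0) \<union> unit_triangle"
    by (simp add: filled_def koch_region_place[of "(1, \<zeta>)"] koch_region_place[of "(\<zeta>, 0)"])
  have 3: "AE z in lborel. z \<in> unit_triangle \<longrightarrow> z \<in> koch_snowflake \<eta>"
  proof (rule AE_I'[OF frontier_null[OF convex_unit_triangle]])
    have "interior unit_triangle \<subseteq> koch_snowflake \<eta>" unfolding S
      using closure_subset[of filled] by (intro interior_mono) (auto simp: filled_def)
    then show "{z \<in> space lborel. \<not> (z \<in> unit_triangle \<longrightarrow> z \<in> koch_snowflake \<eta>)} \<subseteq> frontier unit_triangle"
      using closure_subset[of unit_triangle] by (auto simp: frontier_def)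
  qed
  have "koch_region \<eta> (0, 1) \<subseteq> filled" "koch_region \<eta> (1, \<zeta>) \<subseteq> filled" "koch_region \<eta> (\<zeta>, 0) \<subseteq> filled"
    by (auto simp: filled)
  from 1 2[OF this(1)] 2[OF this(2)] 2[OF this(3)] 3 show ?thesis
    by eventually_elim (auto simp: filled)
qed

end

section \<open>Reduction of the double integral to the loss function\<close>

lemma lborel_integral_affine:
  fixes f :: "'a::euclidean_space \<Rightarrow> real"
  assumes t: "t > 0" and [measurable]: "f \<in> borel_measurable borel"
  shows "(LINT x|lborel. f x) = t ^ DIM('a) * (LINT z|lborel. f (y + t *\<^sub>R z))"
proof -
  have "(LINT x|lborel. f x) = (LINT x|density (distr lborel borel (\<lambda>z. y + t *\<^sub>R z)) (\<lambda>_. ennreal (\<bar>t\<bar> ^ DIM('a))). f x)"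
    using lborel_affine[of t y] t by simp
  also have "\<dots> = (LINT x|distr lborel borel (\<lambda>z. y + t *\<^sub>R z). t ^ DIM('a) *\<^sub>R f x)"
    using t by (subst integral_density) auto
  also have "\<dots> = (LINT z|lborel. t ^ DIM('a) * f (y + t *\<^sub>R z))"
    by (subst integral_distr) auto
  finally show ?thesis by simp
qed

lemma AE_lborel_affine:
  fixes P :: "'a::euclidean_space \<Rightarrow> bool"
  assumes "t > 0" and P: "AE z in lborel. P z"
  shows "AE x in lborel. P ((x - y) /\<^sub>R t)"
proof -
  obtain N where N: "{z. \<not> P z} \<subseteq> N" "N \<in> sets borel" "emeasure lborel N = 0"
    using AE_E[OF P] by (auto simp: null_sets_def) 
  have "AE z in distr lborel borel (\<lambda>x. (- (1 / t) *\<^sub>R y) + (1 / t) *\<^sub>R x). z \<notin> N"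
  proof -
    have "AE z in density (distr lborel borel (\<lambda>x. (- (1 / t) *\<^sub>R y) + (1 / t) *\<^sub>R x))
        (\<lambda>_. ennreal (\<bar>1 / t\<bar> ^ DIM('a))). z \<notin> N"
    proof -
      have "AE z in lborel. z \<notin> N" using N by (intro AE_not_in) (auto simp: null_sets_def)
      moreover have "lborel = density (distr lborel borel (\<lambda>x. (- (1 / t) *\<^sub>R y) + (1 / t) *\<^sub>R x))
          (\<lambda>_. ennreal (\<bar>1 / t\<bar> ^ DIM('a)))"
        by (rule lborel_affine) (use assms in auto)
      ultimately show ?thesis by metis
    qed
    then show ?thesis
      using assms by (subst (asm) AE_density) (auto simp: zero_less_power)
  qed
  then have "AE x in lborel. (- (1 / t) *\<^sub>R y) + (1 / t) *\<^sub>R x \<notin> N"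
    using N by (subst (asm) AE_distr_iff) auto
  then show ?thesis
    by eventually_elim (use N in \<open>auto simp: algebra_simps inverse_eq_divide\<close>)
qed

lemma shift_loss_eq_integral:
  fixes X :: "'a::euclidean_space set"
  assumes "X \<in> fmeasurable lborel"
  shows "shift_loss X h = (LINT y|lborel. indicator X y * indicat_real (- X) (y + h))"
proof -
  have "(LINT y|lborel. indicator X y * indicat_real (- X) (y + h)) =
      (LINT y|lborel. indicat_real {y \<in> X. y + h \<notin> X} y)"
    by (intro Bochner_Integration.integral_cong) (auto simp: indicator_def)
  also have "\<dots> = shift_loss X h" by (simp add: shift_loss_def)
  finally show ?thesis by simp
qed

lemma borel_measurable_shift_loss [measurable]:
  fixes X :: "'a::euclidean_space set"
  assumes X: "X \<in> fmeasurable lborel"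
  shows "shift_loss X \<in> borel_measurable borel"
proof -
  have [measurable]: "X \<in> sets borel" using X by (auto dest: fmeasurableD)
  have "(\<lambda>h. LINT y|lborel. indicator X y * indicat_real (- X) (y + h)) \<in> borel_measurable borel"
    by measurable
  then show ?thesis using shift_loss_eq_integral[OF X] by (simp cong: measurable_cong)
qed

lemma tendsto_at_right_0_iff: "(f \<longlongrightarrow> l) (at_right (0::real)) \<longleftrightarrow> ((\<lambda>u. f (inverse u)) \<longlongrightarrow> l) at_top"
  by (rule filterlim_at_right_to_top)

text \<open>A point of an open set stays in it under all sufficiently small shifts; the indicator of
  X dominates.\<close>

lemma shift_loss_open_tendsto_0:
  fixes X :: "'a::euclidean_space set"
  assumes X: "open X" "X \<in> fmeasurable lborel"
  shows "((\<lambda>t. shift_loss X (t *\<^sub>R h)) \<longlongrightarrow> 0) (at_right 0)"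
proof -
  have [measurable]: "X \<in> sets borel" using X by (auto dest: fmeasurableD)
  have "((\<lambda>u. LINT y|lborel. indicator X y * indicat_real (- X) (y + inverse u *\<^sub>R h)) \<longlongrightarrow> (LINT y|(lborel :: 'a measure). (0::real))) at_top"
  proof (rule integral_dominated_convergence_at_top[where w="indicat_real X"])
    show "integrable lborel (indicat_real X)" using X(2) by (auto simp: fmeasurable_def)
    show "AE y in lborel. ((\<lambda>u. indicator X y * indicat_real (- X) (y + inverse u *\<^sub>R h)) \<longlongrightarrow> 0) at_top"
    proof (intro AE_I2)
      fix y
      have "eventually (\<lambda>u. indicator X y * indicat_real (- X) (y + inverse u *\<^sub>R h) = 0) at_top"
      proof (cases "y \<in> X")
        case True
        have "((\<lambda>u::real. y + inverse u *\<^sub>R h) \<longlongrightarrow> y + 0 *\<^sub>R h) at_top"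
          by (intro tendsto_intros tendsto_inverse_0_at_top filterlim_ident)
        then have "eventually (\<lambda>u. y + inverse u *\<^sub>R h \<in> X) at_top"
          using X(1) True by (auto dest: topological_tendstoD)
        then show ?thesis by eventually_elim simp
      qed simp
      then show "((\<lambda>u. indicator X y * indicat_real (- X) (y + inverse u *\<^sub>R h)) \<longlongrightarrow> 0) at_top"
        by (rule tendsto_eventually)
    qed
    show "\<forall>\<^sub>F u in at_top. AE y in lborel. norm (indicator X y * indicat_real (- X) (y + inverse u *\<^sub>R h)) \<le> indicat_real X y"
      by (auto simp: indicator_def)
  qed measurable
  then show ?thesis
    unfolding tendsto_at_right_0_iff shift_loss_eq_integral[OF X(2)] by simp
qed

text \<open>The substitution x = y + t z gives the factor t^DIM, and Fubini integrates over y first.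
  The Borel version \<open>J'\<close> makes the integrand measurable on the product of the Borel
  Lebesgue measures.\<close>

lemma nonlocal_energy_eq:
  fixes X :: "'a::euclidean_space set" and J :: "'a \<Rightarrow> real"
  assumes X: "X \<in> fmeasurable lborel" and t: "t > 0"
    and J: "J \<in> borel_measurable lebesgue"
    and J' [measurable]: "J' \<in> borel_measurable borel" and int: "integrable lborel J'"
    and ae: "AE z in lborel. J z = J' z"
  shows "(LINT y : X | lebesgue. (LINT x : - X | lebesgue. J ((x - y) /\<^sub>R t))) =
    t ^ DIM('a) * (LINT z|lborel. J' z * shift_loss X (t *\<^sub>R z))"
proof -
  have [measurable]: "X \<in> sets borel" using X by (auto dest: fmeasurableD)
  have inner: "(LINT x : - X | lebesgue. J ((x - y) /\<^sub>R t)) =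
      t ^ DIM('a) * (LINT z|lborel. indicator (- X) (y + t *\<^sub>R z) * J' z)" for y
  proof -
    have "(LINT x : - X | lebesgue. J ((x - y) /\<^sub>R t)) = (LINT x|lebesgue. indicator (- X) x * J' ((x - y) /\<^sub>R t))"
      unfolding set_lebesgue_integral_def
    proof (rule integral_cong_AE)
      have "(\<lambda>x. - (1 / t) *\<^sub>R y + (\<Sum>j\<in>Basis. ((1 / t) * (x \<bullet> j)) *\<^sub>R j)) \<in> lebesgue \<rightarrow>\<^sub>M lebesgue"
        by (rule lebesgue_affine_measurable) (use t in auto)
      also have "(\<lambda>x. - (1 / t) *\<^sub>R y + (\<Sum>j\<in>Basis. ((1 / t) * (x \<bullet> j)) *\<^sub>R j)) = (\<lambda>x. (x - y) /\<^sub>R t)"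
      proof
        fix x :: 'a
        have "(\<Sum>j\<in>Basis. ((1 / t) * (x \<bullet> j)) *\<^sub>R j) = (1 / t) *\<^sub>R (\<Sum>j\<in>Basis. (x \<bullet> j) *\<^sub>R j)"
          by (simp add: scaleR_sum_right)
        then show "- (1 / t) *\<^sub>R y + (\<Sum>j\<in>Basis. ((1 / t) * (x \<bullet> j)) *\<^sub>R j) = (x - y) /\<^sub>R t"
          by (simp add: euclidean_representation algebra_simps inverse_eq_divide)
      qed
      finally have [measurable]: "(\<lambda>x. J ((x - y) /\<^sub>R t)) \<in> borel_measurable lebesgue"
        using J by (rule measurable_compose)
      show "(\<lambda>x. indicat_real (- X) x *\<^sub>R J ((x - y) /\<^sub>R t)) \<in> borel_measurable lebesgue"
        by (intro borel_measurable_scaleR borel_measurable_indicator) auto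
      show "(\<lambda>x. indicator (- X) x * J' ((x - y) /\<^sub>R t)) \<in> borel_measurable lebesgue"
        by (intro measurable_completion) measurable
      show "AE x in lebesgue. indicat_real (- X) x *\<^sub>R J ((x - y) /\<^sub>R t) = indicator (- X) x * J' ((x - y) /\<^sub>R t)"
        using AE_lborel_affine[OF t ae, of y] by (auto simp: AE_completion_iff intro: AE_completion)
    qed
    also have "\<dots> = (LINT x|lborel. indicator (- X) x * J' ((x - y) /\<^sub>R t))"
      by (rule integral_completion) measurable
    also have "\<dots> = t ^ DIM('a) * (LINT z|lborel. indicator (- X) (y + t *\<^sub>R z) * J' ((y + t *\<^sub>R z - y) /\<^sub>R t))"
      by (rule lborel_integral_affine[OF t]) measurable
    finally show ?thesis using t by simp
  qed
  let ?f = "\<lambda>y z. indicat_real X y * (indicat_real (- X) (y + t *\<^sub>R z) * J' z)"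
  have intX: "integrable lborel (indicat_real X)" using X by (auto simp: fmeasurable_def)
  have int2: "integrable (lborel \<Otimes>\<^sub>M lborel) (\<lambda>(y, z). ?f y z)"
  proof (rule Bochner_Integration.integrable_bound)
    show "integrable (lborel \<Otimes>\<^sub>M lborel) (\<lambda>(y, z). indicat_real X y * J' z)"
      using intX int by (intro lborel_pair.Fubini_integrable) (auto simp: abs_mult)
    show "AE p in lborel \<Otimes>\<^sub>M lborel. norm (case p of (y, z) \<Rightarrow> ?f y z) \<le> norm (case p of (y, z) \<Rightarrow> indicat_real X y * J' z)"
      by (auto simp: indicator_def)
  qed measurable
  have "(LINT y : X | lebesgue. (LINT x : - X | lebesgue. J ((x - y) /\<^sub>R t))) =
      (LINT y|lebesgue. t ^ DIM('a) * (LINT z|lborel. ?f y z))"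
    unfolding set_lebesgue_integral_def[of _ X] inner by (simp add: mult.left_commute)
  also have "\<dots> = (LINT y|lborel. t ^ DIM('a) * (LINT z|lborel. ?f y z))"
    by (rule integral_completion) measurable
  also have "\<dots> = t ^ DIM('a) * (LINT y|lborel. (LINT z|lborel. ?f y z))" by simp
  also have "(LINT y|lborel. (LINT z|lborel. ?f y z)) = (LINT z|lborel. (LINT y|lborel. ?f y z))"
    by (rule lborel_pair.Fubini_integral[symmetric]) (use int2 in simp)
  also have "\<dots> = (LINT z|lborel. J' z * shift_loss X (t *\<^sub>R z))"
  proof (rule Bochner_Integration.integral_cong[OF refl])
    fix z
    have "(LINT y|lborel. ?f y z) = (LINT y|lborel. J' z * (indicat_real X y * indicat_real (- X) (y + t *\<^sub>R z)))"
      by (simp add: mult_ac)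
    then show "(LINT y|lborel. ?f y z) = J' z * shift_loss X (t *\<^sub>R z)"
      by (simp add: shift_loss_eq_integral[OF X])
  qed
  finally show ?thesis .
qed

text \<open>Dominated convergence with majorant M |J'| (1 + |z|^2): integrability and the second
  moment of J are what make it integrable.\<close>

lemma nonlocal_energy_tendsto:
  fixes X :: "'a::euclidean_space set" and J :: "'a \<Rightarrow> real" and \<gamma> M :: real
  assumes X: "X \<in> fmeasurable lborel"
    and J: "integrable lebesgue J" and J2: "integrable lebesgue (\<lambda>z. J z * (norm z)\<^sup>2)"
    and lim: "\<And>z. \<exists>l. ((\<lambda>t. shift_loss X (t *\<^sub>R z) / t powr \<gamma>) \<longlongrightarrow> l) (at_right 0)"
    and bound: "\<And>z t. 0 < t \<Longrightarrow> t \<le> 1 \<Longrightarrow> shift_loss X (t *\<^sub>R z) / t powr \<gamma> \<le> M * (1 + (norm z)\<^sup>2)"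
  shows "\<exists>L. ((\<lambda>t. (LINT y : X | lebesgue. (LINT x : - X | lebesgue. J ((x - y) /\<^sub>R t)))
      / t powr (DIM('a) + \<gamma>)) \<longlongrightarrow> L) (at_right 0)"
proof -
  obtain J' where J' [measurable]: "J' \<in> borel_measurable lborel" and ae: "AE z in lborel. J z = J' z"
    using completion_ex_borel_measurable_real[OF borel_measurable_integrable[OF J]] by blast
  have mJ: "J \<in> borel_measurable lebesgue" using J by (rule borel_measurable_integrable)
  have ae': "AE z in lebesgue. J z = J' z" using ae by (rule AE_completion)
  have "integrable lebesgue J'"
    by (rule integrable_cong_AE_imp[OF J]) (use ae' in \<open>auto intro: measurable_completion\<close>)
  then have iJ: "integrable lborel J'" by (simp add: integrable_completion)
  have "integrable lebesgue (\<lambda>z. J' z * (norm z)\<^sup>2)"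
    by (rule integrable_cong_AE_imp[OF J2]) (use ae' in \<open>auto intro!: measurable_completion\<close>)
  then have iJ2: "integrable lborel (\<lambda>z. J' z * (norm z)\<^sup>2)" by (subst (asm) integrable_completion) auto
  obtain l where l: "\<And>z. ((\<lambda>t. shift_loss X (t *\<^sub>R z) / t powr \<gamma>) \<longlongrightarrow> l z) (at_right 0)"
    using lim by metis
  then have l': "((\<lambda>u. shift_loss X (inverse u *\<^sub>R z) / inverse u powr \<gamma>) \<longlongrightarrow> l z) at_top" for z
    by (simp add: tendsto_at_right_0_iff)
  note [measurable] = borel_measurable_shift_loss[OF X]
  \<comment> \<open>The limit is measurable as a limit along the sequence t = 1 / n.\<close>
  have [measurable]: "l \<in> borel_measurable borel"
  proof (rule borel_measurable_LIMSEQ_real)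
    show "(\<lambda>n. shift_loss X (inverse (real n) *\<^sub>R z) / inverse (real n) powr \<gamma>) \<longlonglongrightarrow> l z" for z
      by (rule filterlim_compose[OF l' filterlim_real_sequentially])
  qed measurable
  have "((\<lambda>u. LINT z|lborel. J' z * (shift_loss X (inverse u *\<^sub>R z) / inverse u powr \<gamma>)) \<longlongrightarrow>
      (LINT z|lborel. J' z * l z)) at_top"
  proof (rule integral_dominated_convergence_at_top[where w="\<lambda>z. M * (norm (J' z) + norm (J' z * (norm z)\<^sup>2))"])
    show "integrable lborel (\<lambda>z. M * (norm (J' z) + norm (J' z * (norm z)\<^sup>2)))"
      using iJ iJ2 by (intro integrable_mult_right Bochner_Integration.integrable_add integrable_norm)
    show "AE z in lborel. ((\<lambda>u. J' z * (shift_loss X (inverse u *\<^sub>R z) / inverse u powr \<gamma>)) \<longlongrightarrow> J' z * l z) at_top"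
      by (intro AE_I2 tendsto_intros l')
    show "\<forall>\<^sub>F u in at_top. AE z in lborel. norm (J' z * (shift_loss X (inverse u *\<^sub>R z) / inverse u powr \<gamma>))
        \<le> M * (norm (J' z) + norm (J' z * (norm z)\<^sup>2))"
      using eventually_ge_at_top[of "1::real"]
    proof eventually_elim
      case (elim u)
      have "norm (J' z * (shift_loss X (inverse u *\<^sub>R z) / inverse u powr \<gamma>)) \<le> M * (norm (J' z) + norm (J' z * (norm z)\<^sup>2))" for z
      proof -
        have "norm (J' z * (shift_loss X (inverse u *\<^sub>R z) / inverse u powr \<gamma>)) =
            \<bar>J' z\<bar> * (shift_loss X (inverse u *\<^sub>R z) / inverse u powr \<gamma>)"
          by (simp add: abs_mult)
        also have "\<dots> \<le> \<bar>J' z\<bar> * (M * (1 + (norm z)\<^sup>2))"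
          using elim by (intro mult_left_mono bound) (auto simp: inverse_le_1_iff)
        finally show ?thesis by (simp add: abs_mult algebra_simps)
      qed
      then show ?case by simp
    qed
  qed measurable
  then have "((\<lambda>t. LINT z|lborel. J' z * (shift_loss X (t *\<^sub>R z) / t powr \<gamma>)) \<longlongrightarrow> (LINT z|lborel. J' z * l z)) (at_right 0)"
    by (simp add: tendsto_at_right_0_iff)
  moreover have "eventually (\<lambda>t. (LINT z|lborel. J' z * (shift_loss X (t *\<^sub>R z) / t powr \<gamma>)) =
      (LINT y : X | lebesgue. (LINT x : - X | lebesgue. J ((x - y) /\<^sub>R t))) / t powr (DIM('a) + \<gamma>)) (at_right 0)"
    using eventually_at_right_less[of "0::real"]
  proof eventually_elim
    case (elim t)
    have "(LINT y : X | lebesgue. (LINT x : - X | lebesgue. J ((x - y) /\<^sub>R t))) =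
        t ^ DIM('a) * (LINT z|lborel. J' z * shift_loss X (t *\<^sub>R z))"
      by (rule nonlocal_energy_eq[OF X elim mJ _ iJ ae]) measurable
    moreover have "t powr (DIM('a) + \<gamma>) = t ^ DIM('a) * t powr \<gamma>"
      using elim by (simp add: powr_add powr_realpow)
    ultimately show ?case using elim by simp
  qed
  ultimately show ?thesis by (blast intro: Lim_transform_eventually)
qed

section \<open>The limit\<close>

lemma (in koch) fmeasurable_snowflake: "koch_snowflake \<eta> \<in> fmeasurable lborel"
proof -
  have "bounded (place s ` A)" for s
  proof -
    have "compact (place s ` closure A)"
      using bounded_A by (intro compact_continuous_image continuous_on_place) (simp add: compact_closure)
    then show ?thesis by (rule bounded_subset[OF compact_imp_bounded]) (intro image_mono closure_subset)
  qed
  then have "bounded filled"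
    using bounded_A compact_unit_triangle by (simp add: filled_def compact_imp_bounded)
  then have "bounded (koch_snowflake \<eta>)"
    unfolding snowflake_eq filled_def[symmetric] by (rule bounded_interior[OF bounded_closure])
  then show ?thesis
    using emeasure_bounded_finite by (auto simp: fmeasurable_def koch_snowflake_def)
qed

lemma powr_le_one_plus_square: "0 \<le> x \<Longrightarrow> 0 \<le> b \<Longrightarrow> b \<le> 2 \<Longrightarrow> x powr b \<le> 1 + (x::real)\<^sup>2"
proof (cases "x \<le> 1")
  case True
  assume "0 \<le> x" "0 \<le> b"
  then have "x powr b \<le> 1" using True by (rule_tac powr_le1) auto
  then show ?thesis by (simp add: add_increasing2)
next
  case False
  assume "b \<le> 2"
  then have "x powr b \<le> x powr 2" using False by (intro powr_mono) auto
  then show ?thesis using False by simp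
qed

theorem theorem1p3:
  fixes J :: "complex \<Rightarrow> real" and \<eta> \<alpha> :: real
  assumes J_nonneg: "\<And>z. J z \<ge> 0"
    and J_int: "integrable lebesgue J"
    and J_mom: "integrable lebesgue (\<lambda>z. J z * (norm z)\<^sup>2)"
    and eta: "\<eta> > 1"
    and irr: "1 + (ln 2 - ln (\<eta> - 1)) / ln \<eta> \<notin> \<rat>"
    and alpha: "2 * ((\<eta> - 1) / (2 * \<eta>)) powr \<alpha> + 2 * (1 / \<eta>) powr \<alpha> = 1"
  shows "\<exists>L. ((\<lambda>t. (LINT y : koch_snowflake \<eta> | lebesgue.
                  (LINT x : - koch_snowflake \<eta> | lebesgue. J ((x - y) /\<^sub>R t)))
                / t powr (4 - \<alpha>)) \<longlongrightarrow> L) (at_right 0)"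
proof -
  let ?\<Omega> = "koch_snowflake \<eta>"
  interpret koch \<eta> by standard (rule eta)
  note fm = fmeasurable_snowflake
  have dim: "2 * a powr \<alpha> + 2 * r powr \<alpha> = 1" using alpha by (simp add: a_def r_def)
  \<comment> \<open>Two powers of t come from the substitution in the plane, the remaining 2 -
    \<alpha> normalises the loss.\<close>
  have exponent: "4 - \<alpha> = DIM(complex) + (2 - \<alpha>)" by simp
  show ?thesis
    unfolding exponent
  proof (cases "\<alpha> < 2")
    case True
    \<comment> \<open>For \<alpha> \<le> 1 each power is at least its base, and the equation for
      \<alpha> would give 1 \<ge> 2 a + 2 r = 1 + r.\<close>
    have "1 < \<alpha>"
    proof (rule ccontr)
      assume "\<not> 1 < \<alpha>"
      then have "a \<le> a powr \<alpha>" "r \<le> r powr \<alpha>"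
        using a r powr_mono'[of \<alpha> 1 a] powr_mono'[of \<alpha> 1 r] by auto
      then show False using dim ar r by linarith
    qed
    then interpret koch_dimension \<eta> \<alpha>
      using a r True dim by unfold_locales auto
    \<comment> \<open>The irrational number of the hypothesis is the ratio of the two logarithmic
      scales.\<close>
    have "ln a / ln r = 1 + (ln 2 - ln (\<eta> - 1)) / ln \<eta>"
      using eta by (simp add: a_def r_def ln_div ln_mult field_simps)
    then have irr': "ln a / ln r \<notin> \<rat>" using irr by simp
    have loss: "shift_loss ?\<Omega> h = shift_loss filled h" for h
      by (rule shift_loss_cong_AE[OF fm fmeasurable_filled snowflake_AE])
    obtain M where M: "M \<ge> 0" "\<And>h. shift_loss filled h \<le> M * cmod h powr \<beta>"
      using shift_loss_filled_bound by blast
    have \<beta>_eq: "\<beta> = 2 - \<alpha>" by (rule C.\<beta>_def)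
    show "\<exists>L. ((\<lambda>t. (LINT y : ?\<Omega> | lebesgue. (LINT x : - ?\<Omega> | lebesgue. J ((x - y) /\<^sub>R t)))
        / t powr (DIM(complex) + (2 - \<alpha>))) \<longlongrightarrow> L) (at_right 0)"
    proof (rule nonlocal_energy_tendsto[OF fm J_int J_mom])
      show "\<exists>l. ((\<lambda>t. shift_loss ?\<Omega> (t *\<^sub>R z) / t powr (2 - \<alpha>)) \<longlongrightarrow> l) (at_right 0)" for z
        using shift_loss_filled_tendsto[OF irr', of z] by (simp add: loss scaleR_conv_of_real \<beta>_eq)
      show "shift_loss ?\<Omega> (t *\<^sub>R z) / t powr (2 - \<alpha>) \<le> M * (1 + (norm z)\<^sup>2)" if "0 < t" for z t
      proof -
        have "shift_loss ?\<Omega> (t *\<^sub>R z) / t powr \<beta> \<le> M * cmod (t *\<^sub>R z) powr \<beta> / t powr \<beta>"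
          unfolding loss by (intro divide_right_mono M) auto
        also have "\<dots> = M * cmod z powr \<beta>" using that by (simp add: powr_mult)
        also have "\<dots> \<le> M * (1 + (norm z)\<^sup>2)"
          using \<beta> by (intro mult_left_mono powr_le_one_plus_square M) auto
        finally show ?thesis by (simp add: \<beta>_eq)
      qed
    qed
  next
    \<comment> \<open>Now t^(2 - \<alpha>) \<ge> 1 for t \<le> 1, so the normalised loss is at most
      the loss itself and tends to 0.\<close>
    case False
    have small: "shift_loss ?\<Omega> (t *\<^sub>R z) / t powr (2 - \<alpha>) \<le> shift_loss ?\<Omega> (t *\<^sub>R z)" if "0 < t" "t \<le> 1" for z t
    proof -
      have "1 \<le> t powr (2 - \<alpha>)"
        using powr_mono'[of "2 - \<alpha>" 0 t] that False by simp
      then show ?thesis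
        using that mult_left_mono[of 1 "t powr (2 - \<alpha>)" "shift_loss ?\<Omega> (t *\<^sub>R z)"]
        by (simp add: divide_le_eq)
    qed
    have opn: "open ?\<Omega>" by (simp add: koch_snowflake_def)
    show "\<exists>L. ((\<lambda>t. (LINT y : ?\<Omega> | lebesgue. (LINT x : - ?\<Omega> | lebesgue. J ((x - y) /\<^sub>R t)))
        / t powr (DIM(complex) + (2 - \<alpha>))) \<longlongrightarrow> L) (at_right 0)"
    proof (rule nonlocal_energy_tendsto[OF fm J_int J_mom])
      show "\<exists>l. ((\<lambda>t. shift_loss ?\<Omega> (t *\<^sub>R z) / t powr (2 - \<alpha>)) \<longlongrightarrow> l) (at_right 0)" for z
      proof (intro exI[of _ 0] tendsto_sandwich[OF _ _ tendsto_const shift_loss_open_tendsto_0[OF opn fm, of z]])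
        show "\<forall>\<^sub>F t in at_right 0. shift_loss ?\<Omega> (t *\<^sub>R z) / t powr (2 - \<alpha>) \<le> shift_loss ?\<Omega> (t *\<^sub>R z)"
          using eventually_at_right_real[OF zero_less_one]
          by eventually_elim (simp add: small)
      qed simp
      show "shift_loss ?\<Omega> (t *\<^sub>R z) / t powr (2 - \<alpha>) \<le> measure lborel ?\<Omega> * (1 + (norm z)\<^sup>2)"
        if "0 < t" "t \<le> 1" for z t
      proof -
        have "measure lborel ?\<Omega> * 1 \<le> measure lborel ?\<Omega> * (1 + (norm z)\<^sup>2)"
          by (intro mult_left_mono) auto
        then show ?thesis using small[OF that, of z] shift_loss_le_measure[OF fm, of "t *\<^sub>R z"] by linarith
      qed
    qed
  qed
qed

end
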